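(* If the geometric realization of $C(n_1,n_2,n_3)$ is a surface without boundary, then it is homeomorphic either to a disjoint union of tori or to a disjoint union of 2-spheres.
   Context: Standing conventions: $N,n_1,n_2,n_3$ are positive integers with $n_1+n_2+n_3=N$ and $1\le n_1\le n_2\le n_3<N$. $C(n_1,n_2,n_3)$ denotes the abstract simplicial complex whose vertex set is $\mathbb{Z}/N$, whose 2-simplices are all sets of the form $\{k,k+n_1,k+n_1+n_2\}$ or $\{k,k-n_1,k-n_1-n_2\}$ for $k\in\mathbb{Z}/N$ (i.e. the orbit of $\{0,n_1,n_1+n_2\}$ under all translations $x\mapsto x+t$ and inversions $x\mapsto t-x$ of $\mathbb{Z}/N$), and whose 1-simplices are all sets $\{k,k+n_i\}$ with $k\in\mathbb{Z}/N$, $i\in\{1,2,3\}$. A surface without boundary is a second countable Hausdorff space locally homeomorphic to open subsets of $\mathbb{R}^2$. *)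

theory Defs
  imports "HOL-Analysis.Analysis"
begin

text \<open>Vertices of C(n1,n2,n3) are the residues 0..N-1 (as integers), N = n1+n2+n3;
  Z/N is represented by integers reduced mod N.\<close>

definition cyc_N :: "nat \<Rightarrow> nat \<Rightarrow> nat \<Rightarrow> int" where
  "cyc_N n1 n2 n3 = int (n1 + n2 + n3)"

definition cyc_triangles :: "nat \<Rightarrow> nat \<Rightarrow> nat \<Rightarrow> int set set" where
  "cyc_triangles n1 n2 n3 =
     {{k mod cyc_N n1 n2 n3, (k + int n1) mod cyc_N n1 n2 n3, (k + int n1 + int n2) mod cyc_N n1 n2 n3} | k. True}
   \<union> {{k mod cyc_N n1 n2 n3, (k - int n1) mod cyc_N n1 n2 n3, (k - int n1 - int n2) mod cyc_N n1 n2 n3} | k. True}"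

definition cyc_edges :: "nat \<Rightarrow> nat \<Rightarrow> nat \<Rightarrow> int set set" where
  "cyc_edges n1 n2 n3 =
     {{k mod cyc_N n1 n2 n3, (k + int n) mod cyc_N n1 n2 n3} | k n. n \<in> {n1, n2, n3}}"

definition cyc_vertices :: "nat \<Rightarrow> nat \<Rightarrow> nat \<Rightarrow> int set set" where
  "cyc_vertices n1 n2 n3 = {{k mod cyc_N n1 n2 n3} | k. True}"

definition cyc_complex :: "nat \<Rightarrow> nat \<Rightarrow> nat \<Rightarrow> int set set" where
  "cyc_complex n1 n2 n3 = cyc_vertices n1 n2 n3 \<union> cyc_edges n1 n2 n3 \<union> cyc_triangles n1 n2 n3"

text \<open>Standard geometric realization of an abstract simplicial complex K with vertices of
  type 'v: the points are barycentric-coordinate functions supported on a simplex of K,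
  topologised as a subspace of the product space (real^'v with product topology).
  For finite complexes this is the usual realization.\<close>
definition geom_realization_set :: "'v set set \<Rightarrow> ('v \<Rightarrow> real) set" where
  "geom_realization_set K =
     {f. \<exists>\<sigma>\<in>K. (\<forall>v. f v \<noteq> 0 \<longrightarrow> v \<in> \<sigma>) \<and> (\<forall>v. 0 \<le> f v) \<and> sum f \<sigma> = 1}"

definition geom_realization :: "'v set set \<Rightarrow> ('v \<Rightarrow> real) topology" where
  "geom_realization K =
     subtopology (product_topology (\<lambda>_. euclideanreal) UNIV) (geom_realization_set K)"

definition surface_without_boundary :: "'a topology \<Rightarrow> bool" where
  "surface_without_boundary X \<longleftrightarrow>
     second_countable X \<and> Hausdorff_space X \<and>
     (\<forall>x\<in>topspace X. \<exists>U. openin X U \<and> x \<in> U \<and>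
        (\<exists>V :: (real^2) set. open V \<and> subtopology X U homeomorphic_space top_of_set V))"

definition torus_space :: "(complex \<times> complex) topology" where
  "torus_space = prod_topology (top_of_set (sphere 0 1)) (top_of_set (sphere 0 1))"

definition sphere2_space :: "(real^3) topology" where
  "sphere2_space = top_of_set (sphere 0 1)"

end

theory Submission
  imports Defs
begin

text \<open>Send e1, e2, - e1 - e2 in the triangular lattice to n1, n2, n3 in Z/N. If n1, n2, n3 are distinct
  and n3 \<noteq> n1 + n2, this map is injective on the closed star of every lattice vertex, so each
  component of the realization is the plane modulo the kernel, a lattice of rank two, hence a torus.
  If (n1, n2, n3) = (a, a, 2a), every component is the boundary of a tetrahedron. In all remaining
  cases some edge lies in only one triangle or in at least three, and invariance of domain shows
  that the realization is not a surface.\<close>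

section \<open>Gluing and geometric realizations\<close>

text \<open>Points of the realization are functions on the vertices, so one global formula in hat
  functions gives the map from the plane, with no charts to glue. A local hypothesis suffices
  because the weights on one closed star determine a position relative to its centre: two points
  with the same image differ by a vector between equally labelled lattice vertices, that is, by a
  relation between n1 and n2 modulo N. Components are counted by the labels that the lattice
  reaches: gcd(n1, n2, N) tori, and a spheres for (a, a, 2a). Inverse maps need no separate
  continuity proof, as the pieces are compact and the surface hypothesis supplies the Hausdorff
  property. Two vertices of a star share a residue exactly if n1 = n2, n2 = n3 or n3 = n1 + n2. In
  the first two cases all triangles are progressions with one step, whose end points span a free
  edge unless N is four steps; in the last one n3 is half of N, so that an edge equals its own
  reverse and collects twice as many triangles.\<close>

lemma homeomorphic_space_sum_topologyI:
  assumes cont: "\<And>i. i \<in> I \<Longrightarrow> continuous_map Y X (g i)"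
    and inj: "\<And>i j y z. \<lbrakk>i \<in> I; j \<in> I; y \<in> topspace Y; z \<in> topspace Y; g i y = g j z\<rbrakk> \<Longrightarrow> i = j \<and> y = z"
    and onto: "\<And>x. x \<in> topspace X \<Longrightarrow> \<exists>i\<in>I. \<exists>y\<in>topspace Y. g i y = x"
    and "finite I" "compact_space Y" "Hausdorff_space X"
  shows "X homeomorphic_space sum_topology (\<lambda>i. Y) I"
proof -
  let ?S = "sum_topology (\<lambda>i. Y) I" and ?G = "\<lambda>(i, y). g i y"
  have img: "?G ` topspace ?S = topspace X"
    using cont onto by (fastforce simp: continuous_map_def Pi_iff)
  have "continuous_map ?S X ?G"
    unfolding continuous_map_def
  proof (intro conjI allI impI)
    show "?G \<in> topspace ?S \<rightarrow> topspace X"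
      using img by blast
    fix U assume "openin X U"
    then have "openin Y {y \<in> topspace Y. g i y \<in> U}" if "i \<in> I" for i
      using cont[OF that] by (simp add: continuous_map_def)
    then show "openin ?S {x \<in> topspace ?S. ?G x \<in> U}"
      by (auto simp: openin_sum_topology)
  qed
  \<comment> \<open>Each \<open>g i\<close> is closed, being continuous from a compact to a
    Hausdorff space; finiteness of \<open>I\<close> keeps the union of the images closed.\<close>
  moreover have "closed_map ?S X ?G"
    unfolding closed_map_def
  proof (intro allI impI)
    fix C assume "closedin ?S C"
    then obtain T where T: "C = Sigma I T" "\<And>i. i \<in> I \<Longrightarrow> closedin Y (T i)"
      by (auto simp: closedin_sum_topology_alt)
    have "closedin X (g i ` T i)" if "i \<in> I" for i
      using continuous_imp_closed_map[OF cont[OF that]] T that assms by (auto simp: closed_map_def)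
    moreover have "?G ` C = (\<Union>i\<in>I. g i ` T i)"
      unfolding T(1) by force
    ultimately show "closedin X (?G ` C)"
      using \<open>finite I\<close> by (auto intro!: closedin_Union)
  qed
  moreover have "inj_on ?G (topspace ?S)"
    using inj by (force simp: inj_on_def)
  ultimately have "homeomorphic_map ?S X ?G"
    using img by (intro bijective_closed_imp_homeomorphic_map) auto
  then show ?thesis
    by (meson homeomorphic_map_imp_homeomorphic_space homeomorphic_space_sym)
qed

lemma mod_eqI:
  fixes b n :: int
  assumes "0 \<le> b" "b < n" "x = b + c * n"
  shows "x mod n = b"
  using assms by simp

lemma topspace_geom_realization [simp]: "topspace (geom_realization K) = geom_realization_set K"
  by (simp add: geom_realization_def)

lemma continuous_map_geom_realization_iff:
  "continuous_map Y (geom_realization K) g \<longleftrightarrow>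
     g \<in> topspace Y \<rightarrow> geom_realization_set K \<and> (\<forall>v. continuous_map Y euclideanreal (\<lambda>y. g y v))"
  by (auto simp: geom_realization_def continuous_map_in_subtopology continuous_map_componentwise_UNIV)

text \<open>Separating the support bound \<open>A\<close> from the simplex \<tau> places an edge
  midpoint in the realization through any simplex containing the edge.\<close>

lemma geom_realization_setI:
  assumes "\<tau> \<in> K" "finite A" "finite \<tau>" "A \<subseteq> \<tau>" "\<And>v. v \<notin> A \<Longrightarrow> f v = 0" "\<And>v. v \<in> A \<Longrightarrow> 0 \<le> f v" "sum f A = 1"
  shows "f \<in> geom_realization_set K"
proof -
  have "sum f \<tau> = sum f A"
    using assms by (intro sum.mono_neutral_right) auto
  moreover have "0 \<le> f v" for v
    using assms(5,6) by (cases "v \<in> A") auto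
  ultimately have "(\<forall>v. f v \<noteq> 0 \<longrightarrow> v \<in> \<tau>) \<and> (\<forall>v. 0 \<le> f v) \<and> sum f \<tau> = 1"
    using assms by auto
  then show ?thesis
    unfolding geom_realization_set_def using \<open>\<tau> \<in> K\<close> by (intro CollectI bexI)
qed

lemma surface_chartE:
  assumes "surface_without_boundary X" "x \<in> topspace X"
  obtains U V h k where "openin X U" "x \<in> U" "open (V :: (real^2) set)"
    "homeomorphic_maps (subtopology X U) (top_of_set V) h k"
proof -
  obtain U and V :: "(real^2) set"
    where "openin X U" "x \<in> U" "open V" "subtopology X U homeomorphic_space top_of_set V"
    using assms unfolding surface_without_boundary_def by meson
  with that show thesis
    unfolding homeomorphic_space_def by meson
qed

section \<open>Edges that obstruct a surface structure\<close>

text \<open>Near the midpoint of such an edge the realization embeds into a half-plane with the midpoint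
  on its boundary line, which invariance of domain forbids on a surface.\<close>
lemma not_surface_if_free_edge:
  assumes "\<tau> \<in> K" "finite \<tau>" "u \<in> \<tau>" "v \<in> \<tau>" and ne: "u \<noteq> v" "w \<noteq> u" "w \<noteq> v"
    and free: "\<And>\<sigma>. \<lbrakk>\<sigma> \<in> K; u \<in> \<sigma>; v \<in> \<sigma>\<rbrakk> \<Longrightarrow> \<sigma> \<subseteq> {u, v, w}"
  shows "\<not> surface_without_boundary (geom_realization K)"
proof
  let ?X = "geom_realization K"
  assume surf: "surface_without_boundary ?X"
  define x where "x = (\<lambda>z. if z = u \<or> z = v then 1/2 else 0 :: real)"
  have "x \<in> topspace ?X"
    using assms by (auto simp: x_def split: if_splits intro!: geom_realization_setI[of \<tau> _ "{u,v}"])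
  then obtain U V h k where U: "openin ?X U" "x \<in> U" and V: "open (V :: (real^2) set)"
    and hk: "homeomorphic_maps (subtopology ?X U) (top_of_set V) h k"
    by (rule surface_chartE[OF surf])
  have UX: "U \<subseteq> topspace ?X"
    using U openin_subset by blast
  then have top: "topspace (subtopology ?X U) = U"
    by auto
  have kcont: "continuous_map (top_of_set V) (subtopology ?X U) k"
    and hV: "h x \<in> V" and khx: "k (h x) = x" and hk': "\<And>y. y \<in> V \<Longrightarrow> h (k y) = y"
    and kU: "\<And>y. y \<in> V \<Longrightarrow> k y \<in> U"
    using hk U UX unfolding homeomorphic_maps_def top continuous_map_def topspace_euclidean_subtopology by auto
  have coord: "continuous_on V (\<lambda>y. k y z)" for z
  proof -
    have "continuous_map (top_of_set V) ?X k"
      using kcont continuous_map_in_subtopology by blast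
    then show ?thesis
      by (simp add: continuous_map_geom_realization_iff)
  qed
  \<comment> \<open>Positive weight at both \<open>u\<close> and \<open>v\<close> forces the
    supporting simplex to contain the edge, so that \<open>free\<close> applies.\<close>
  define V' where "V' = {y \<in> V. k y u > 0 \<and> k y v > 0}"
  have "V' = (V \<inter> (\<lambda>y. k y u) -` {0<..}) \<inter> (V \<inter> (\<lambda>y. k y v) -` {0<..})"
    by (auto simp: V'_def)
  then have V': "open V'" "V' \<subseteq> V"
    using continuous_open_preimage[OF coord V open_greaterThan] by (metis open_Int, auto)
  have tri: "k y u + k y v + k y w = 1 \<and> k y w \<ge> 0 \<and> (\<forall>z. z \<notin> {u,v,w} \<longrightarrow> k y z = 0)" if "y \<in> V'" for y
  proof -
    have y: "y \<in> V" "k y u > 0" "k y v > 0"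
      using that by (auto simp: V'_def)
    then have "k y \<in> geom_realization_set K"
      using kU UX by auto
    then obtain \<sigma> where \<sigma>: "\<sigma> \<in> K" "\<And>z. k y z \<noteq> 0 \<Longrightarrow> z \<in> \<sigma>" "\<And>z. k y z \<ge> 0" "sum (k y) \<sigma> = 1"
      by (auto simp: geom_realization_set_def)
    then have sub: "\<sigma> \<subseteq> {u,v,w}"
      using y by (intro free) auto
    then have "sum (k y) {u,v,w} = sum (k y) \<sigma>"
      using \<sigma>(2) by (intro sum.mono_neutral_right) auto
    then show ?thesis
      using ne \<sigma> sub by auto
  qed
  \<comment> \<open>The weight of \<open>v\<close> is the remainder, so these two coordinates
    determine the point; the second is never negative.\<close>
  define m where "m y = (k y u, k y w)" for y
  have "inj_on m V'"
  proof (rule inj_onI)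
    fix y y' assume yy: "y \<in> V'" "y' \<in> V'" "m y = m y'"
    then have "k y = k y'"
      using tri[of y] tri[of y'] by (intro ext) (smt (verit) insertE m_def prod.inject singletonD)
    then show "y = y'"
      using hk' yy V' by (metis subsetD)
  qed
  moreover have "continuous_on V' m"
    unfolding m_def using V' coord by (auto intro!: continuous_on_Pair intro: continuous_on_subset)
  ultimately have "open (m ` V')"
    using V' by (intro invariance_of_domain_gen) auto
  moreover have "(1/2, 0) \<in> m ` V'"
    using hV khx ne by (intro image_eqI[of _ _ "h x"]) (auto simp: m_def V'_def x_def)
  ultimately obtain e where e: "e > 0" "ball (1/2, 0) e \<subseteq> m ` V'"
    using open_contains_ball by blast
  \<comment> \<open>A point of the ball on the forbidden side of the boundary line.\<close>
  have "(1/2, - (e/2)) \<in> ball (1/2, 0) e"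
    using e by (simp add: dist_Pair_Pair)
  then obtain y where "y \<in> V'" "m y = (1/2, - (e/2))"
    using e by (metis imageE subsetD)
  then show False
    using tri[of y] e by (auto simp: m_def)
qed

text \<open>Two of the three triangles form a disc around the midpoint of the common edge. On a surface,
  invariance of domain makes this disc a neighbourhood of the midpoint, although it misses the
  interior of the third triangle.\<close>
lemma not_surface_if_branching_edge:
  assumes K: "{u, v, w1} \<in> K" "{u, v, w2} \<in> K" "{u, v, w3} \<in> K" and dist: "distinct [u, v, w1, w2, w3]"
  shows "\<not> surface_without_boundary (geom_realization K)"
proof
  let ?X = "geom_realization K"
  assume surf: "surface_without_boundary ?X"
  \<comment> \<open>The first coordinate of \<open>p\<close> slides along the edge; the second,
    according to its sign, shifts weight to \<open>w1\<close> or \<open>w2\<close>, taken in equal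
    halves from \<open>u\<close> and \<open>v\<close>.\<close>
  define e :: "real \<times> real \<Rightarrow> _ \<Rightarrow> real" where
    "e p = (\<lambda>z. if z = u then 1/2 + fst p - \<bar>snd p\<bar>/2 else if z = v then 1/2 - fst p - \<bar>snd p\<bar>/2
       else if z = w1 then max (snd p) 0 else if z = w2 then max (- snd p) 0 else 0)" for p
  define c :: "real \<Rightarrow> _ \<Rightarrow> real" where
    "c t = (\<lambda>z. if z = u \<or> z = v then 1/2 - t/2 else if z = w3 then t else 0)" for t
  \<comment> \<open>The bound 1/4 keeps the weights of \<open>u\<close> and \<open>v\<close> above
    1/2 - 1/4 - 1/8 > 0.\<close>
  define D :: "(real \<times> real) set" where "D = {-1/4<..<1/4} \<times> {-1/4<..<1/4}"
  have D: "open D"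
    by (simp add: D_def open_Times)
  have eX: "e p \<in> topspace ?X" if "p \<in> D" for p
  proof (cases "snd p \<ge> 0")
    case True
    then show ?thesis
      using that dist K by (auto simp: D_def e_def split: if_splits intro!: geom_realization_setI[of "{u,v,w1}" _ "{u,v,w1}"])
  next
    case False
    then show ?thesis
      using that dist K by (auto simp: D_def e_def split: if_splits intro!: geom_realization_setI[of "{u,v,w2}" _ "{u,v,w2}"])
  qed
  have econt: "continuous_map (top_of_set D) ?X e"
    unfolding continuous_map_geom_realization_iff
  proof (intro conjI allI)
    show "e \<in> topspace (top_of_set D) \<rightarrow> geom_realization_set K"
      using eX by auto
    show "continuous_map (top_of_set D) euclideanreal (\<lambda>p. e p z)" for z
      unfolding e_def
      by (cases "z = u"; cases "z = v"; cases "z = w1"; cases "z = w2"; simp; intro continuous_intros; simp)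
  qed
  have ccont: "continuous_map (top_of_set {0..<1/4}) ?X c"
    unfolding continuous_map_geom_realization_iff
  proof (intro conjI allI)
    show "c \<in> topspace (top_of_set {0..<1/4}) \<rightarrow> geom_realization_set K"
      using dist K by (auto simp: c_def split: if_splits intro!: geom_realization_setI[of "{u,v,w3}" _ "{u,v,w3}"])
    show "continuous_map (top_of_set {0..<1/4}) euclideanreal (\<lambda>p. c p z)" for z
      unfolding c_def
      by (cases "z = u \<or> z = v"; cases "z = w3"; simp; intro continuous_intros; simp)
  qed
  have e0: "e (0,0) = c 0"
    using dist by (auto simp: e_def c_def)
  obtain U V h k where U: "openin ?X U" "e (0,0) \<in> U" and V: "open (V :: (real^2) set)"
    and hk: "homeomorphic_maps (subtopology ?X U) (top_of_set V) h k"
    by (rule surface_chartE[OF surf eX[of "(0,0)"]]) (auto simp: D_def)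
  have UX: "U \<subseteq> topspace ?X"
    using U openin_subset by blast
  then have top: "topspace (subtopology ?X U) = U"
    by auto
  have hcont: "continuous_map (subtopology ?X U) (top_of_set V) h"
    and kh: "\<And>f. f \<in> U \<Longrightarrow> k (h f) = f"
    using hk UX unfolding homeomorphic_maps_def top by auto
  define D' where "D' = {p \<in> D. e p \<in> U}"
  have "openin (top_of_set D) D'"
    using econt U by (auto simp: D'_def continuous_map_def)
  then have D': "open D'" "D' \<subseteq> D"
    using D by (auto simp: openin_open_eq)
  have "inj_on (h \<circ> e) D'"
  proof (rule inj_onI)
    fix p q assume pq: "p \<in> D'" "q \<in> D'" "(h \<circ> e) p = (h \<circ> e) q"
    then have "e p = e q"
      using kh by (metis (mono_tags, lifting) D'_def comp_apply mem_Collect_eq)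
    then have "e p u = e q u" "e p w1 = e q w1" "e p w2 = e q w2"
      by auto
    then show "p = q"
      using dist by (auto simp: e_def max_def prod_eq_iff split: if_splits)
  qed
  moreover have "continuous_on D' (h \<circ> e)"
  proof -
    have "continuous_map (top_of_set D') (subtopology ?X U) e"
      using econt D' continuous_map_from_subtopology_mono[of euclidean D ?X e D']
      by (auto simp: continuous_map_in_subtopology D'_def)
    then have "continuous_map (top_of_set D') (top_of_set V) (h \<circ> e)"
      using hcont continuous_map_compose by blast
    then show ?thesis
      by (auto simp: continuous_map_in_subtopology)
  qed
  ultimately have "open ((h \<circ> e) ` D')"
    using D' by (intro invariance_of_domain_gen) auto
  \<comment> \<open>Openness in the plane is carried back through the chart: the image of
    \<open>D'\<close> under \<open>e\<close> becomes open in the realization.\<close>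
  then have "openin (top_of_set V) (V \<inter> (h \<circ> e) ` D')"
    by (simp add: openin_open_Int)
  then have "openin (subtopology ?X U) {f \<in> U. h f \<in> V \<inter> (h \<circ> e) ` D'}"
    using hcont top unfolding continuous_map_def by metis
  moreover have "{f \<in> U. h f \<in> V \<inter> (h \<circ> e) ` D'} = e ` D'"
  proof -
    have "h f \<in> V" if "f \<in> U" for f
      using hcont that top by (auto simp: continuous_map_def)
    moreover have "f \<in> e ` D'" if "f \<in> U" "h f = h (e p)" "p \<in> D'" for f p
      using that kh by (metis (mono_tags, lifting) D'_def image_eqI mem_Collect_eq)
    ultimately show ?thesis
      by (auto simp: D'_def)
  qed
  ultimately have "openin ?X (e ` D')"
    using U openin_trans_full by metis
  then have "openin (top_of_set {0..<1/4}) {t \<in> {0..<1/4}. c t \<in> e ` D'}"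
    using ccont by (auto simp: continuous_map_def)
  \<comment> \<open>On the disc the weight of \<open>w3\<close> is zero, while at \<open>c t\<close>
    it is t.\<close>
  moreover have "{t \<in> {0..<1/4}. c t \<in> e ` D'} = {0}"
  proof -
    have "t = 0" if "c t = e p" for t p
      using fun_cong[OF that, of w3] dist by (auto simp: c_def e_def)
    moreover have "c 0 \<in> e ` D'"
      using e0 U by (intro image_eqI[of _ _ "(0,0)"]) (auto simp: D'_def D_def)
    ultimately show ?thesis
      by auto
  qed
  ultimately have "openin (top_of_set {0..<1/4}) {0 :: real}"
    by simp
  then obtain \<epsilon> :: real where \<epsilon>: "\<epsilon> > 0" "ball 0 \<epsilon> \<inter> {0..<1/4} \<subseteq> {0 :: real}"
    by (auto simp: openin_contains_ball)
  have "min (\<epsilon>/2) (1/8) \<in> ball 0 \<epsilon> \<inter> {0..<1/4}"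
    using \<epsilon>(1) by (auto simp: min_def)
  then have "min (\<epsilon>/2) (1/8) = 0"
    using \<epsilon>(2) by blast
  then show False
    using \<epsilon>(1) by (auto simp: min_def split: if_splits)
qed

section \<open>The triangulated plane over a cyclic complex\<close>

text \<open>The piecewise linear hat function of the vertex 0 in the triangulation of the plane with vertex
  set Z^2 and edge directions (1,0), (0,1) and (1,1).\<close>
definition hexhat :: "real \<Rightarrow> real \<Rightarrow> real" where
  "hexhat a b = max 0 (1 - max (max \<bar>a\<bar> \<bar>b\<bar>) \<bar>a - b\<bar>)"

lemma hexhat_nonzero_iff: "hexhat a b \<noteq> 0 \<longleftrightarrow> \<bar>a\<bar> < 1 \<and> \<bar>b\<bar> < 1 \<and> \<bar>a - b\<bar> < 1"
  by (auto simp: hexhat_def max_def)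

lemma hexhat_eqI:
  assumes "\<bar>a\<bar> \<le> 1 - c" "\<bar>b\<bar> \<le> 1 - c" "\<bar>a - b\<bar> \<le> 1 - c" "c \<ge> 0"
    and "\<bar>a\<bar> = 1 - c \<or> \<bar>b\<bar> = 1 - c \<or> \<bar>a - b\<bar> = 1 - c"
  shows "hexhat a b = c"
  using assms by (auto simp: hexhat_def max_def)

text \<open>A point is the sum of the vertices weighted by its barycentric coordinates. In the open
  star of the origin only the six neighbours can contribute, and each coordinate sees the four of
  them where it is 1 or -1.\<close>

lemma hexhat_reconstruct:
  assumes "hexhat a b \<noteq> 0"
  shows "hexhat (a - 1) b + hexhat (a - 1) (b - 1) - hexhat (a + 1) b - hexhat (a + 1) (b + 1) = a"
    and "hexhat a (b - 1) + hexhat (a - 1) (b - 1) - hexhat a (b + 1) - hexhat (a + 1) (b + 1) = b"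
proof -
  have ab: "\<bar>a\<bar> < 1" "\<bar>b\<bar> < 1" "\<bar>a - b\<bar> < 1"
    using assms by (auto simp: hexhat_nonzero_iff)
  have *: "hexhat (a - 1) b = max 0 (min a (a - b))" "hexhat (a - 1) (b - 1) = max 0 (min a b)"
    "hexhat (a + 1) b = max 0 (min (- a) (b - a))" "hexhat (a + 1) (b + 1) = max 0 (min (- a) (- b))"
    "hexhat a (b - 1) = max 0 (min b (b - a))" "hexhat a (b + 1) = max 0 (min (- b) (a - b))"
    using ab unfolding hexhat_def by (smt (verit))+
  show "hexhat (a - 1) b + hexhat (a - 1) (b - 1) - hexhat (a + 1) b - hexhat (a + 1) (b + 1) = a"
    and "hexhat a (b - 1) + hexhat (a - 1) (b - 1) - hexhat a (b + 1) - hexhat (a + 1) (b + 1) = b"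
    unfolding * by (smt (verit))+
qed

text \<open>Sends a point of the plane with barycentric coordinates c_u in that triangulation to the sum of
  c_u times the vertex r + u1 n1 + u2 n2 mod N of the complex. The summation range is finite.\<close>
definition hexmap :: "int \<Rightarrow> int \<Rightarrow> int \<Rightarrow> int \<Rightarrow> real \<Rightarrow> real \<Rightarrow> int \<Rightarrow> real" where
  "hexmap n1 n2 N r x y w =
     (\<Sum>(i, j) \<in> {(i, j). hexhat (x - of_int i) (y - of_int j) \<noteq> 0 \<and> (r + i * n1 + j * n2) mod N = w}.
        hexhat (x - of_int i) (y - of_int j))"

text \<open>The index set in \<open>hexmap\<close> moves with the point; a fixed finite superset
  makes the sum computable and visibly continuous.\<close>

lemma hexmap_eq_sum:
  assumes "finite B" "\<And>i j. hexhat (x - of_int i) (y - of_int j) \<noteq> 0 \<Longrightarrow> (i, j) \<in> B"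
  shows "hexmap n1 n2 N r x y w =
    (\<Sum>(i, j)\<in>B. if (r + i * n1 + j * n2) mod N = w then hexhat (x - of_int i) (y - of_int j) else 0)"
  unfolding hexmap_def using assms by (intro sum.mono_neutral_cong_left) (auto split: if_splits)

text \<open>Labels may still coincide modulo \<open>N\<close>, so the three barycentric weights are
  added instead of being separate cases.\<close>

lemma hexmap_upper_triangle:
  assumes "c1 \<ge> 0" "c2 \<ge> 0" "c1 + c2 \<le> 1"
  shows "hexmap n1 n2 N r (of_int i + c1 + c2) (of_int j + c2) w =
      (if (r + i * n1 + j * n2) mod N = w then 1 - c1 - c2 else 0)
    + (if (r + (i + 1) * n1 + j * n2) mod N = w then c1 else 0)
    + (if (r + (i + 1) * n1 + (j + 1) * n2) mod N = w then c2 else 0)"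
proof -
  let ?x = "of_int i + c1 + c2" and ?y = "of_int j + c2"
  have "(i', j') \<in> {(i, j), (i + 1, j), (i + 1, j + 1)}"
    if "hexhat (?x - of_int i') (?y - of_int j') \<noteq> 0" for i' j'
  proof -
    have "\<bar>?x - of_int i'\<bar> < 1" "\<bar>?y - of_int j'\<bar> < 1" "\<bar>?x - of_int i' - (?y - of_int j')\<bar> < 1"
      using that by (auto simp: hexhat_nonzero_iff)
    \<comment> \<open>Integrality leaves 0 and 1 for both offsets; the last bound discards (0, 1),
      the corner of the other half of the square.\<close>
    then have "real_of_int (i' - i) > -1" "real_of_int (i' - i) < 2"
      "real_of_int (j' - j) > -1" "real_of_int (j' - j) < 2"
      "real_of_int (i' - i - (j' - j)) > -1"
      using assms by (simp_all add: abs_less_iff)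
    then have "i' - i > -1" "i' - i < 2" "j' - j > -1" "j' - j < 2" "i' - i - (j' - j) > -1"
      by linarith+
    then show ?thesis
      by auto
  qed
  moreover have "hexhat (?x - of_int i) (?y - of_int j) = 1 - c1 - c2"
    "hexhat (?x - of_int (i + 1)) (?y - of_int j) = c1"
    "hexhat (?x - of_int (i + 1)) (?y - of_int (j + 1)) = c2"
    using assms by (intro hexhat_eqI; simp)+
  ultimately show ?thesis
    by (subst hexmap_eq_sum[of "{(i, j), (i + 1, j), (i + 1, j + 1)}"]) auto
qed

text \<open>Reflection in the diagonal preserves the hat function and exchanges the two triangles of
  each unit square; it reduces lower triangles to upper ones.\<close>

lemma hexmap_swap: "hexmap n1 n2 N r x y w = hexmap n2 n1 N r y x w"
proof -
  have "hexhat a b = hexhat b a" for a b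
    by (simp add: hexhat_def max.commute abs_minus_commute)
  then show ?thesis
    unfolding hexmap_def
    by (intro sum.reindex_bij_witness[of _ prod.swap prod.swap]) (auto simp: algebra_simps)
qed

text \<open>Translation by a relation permutes the lattice vertices and keeps all labels, so it only
  reindexes the sum.\<close>

lemma hexmap_periodic:
  assumes "(a * n1 + b * n2) mod N = 0"
  shows "hexmap n1 n2 N r (x + of_int a) (y + of_int b) w = hexmap n1 n2 N r x y w"
proof -
  have add: "(r + (i + a) * n1 + (j + b) * n2) mod N = (r + i * n1 + j * n2) mod N" for i j
    using assms by (simp add: mod_eq_dvd_iff mod_eq_0_iff_dvd algebra_simps)
  have diff: "(r + (i - a) * n1 + (j - b) * n2) mod N = (r + i * n1 + j * n2) mod N" for i j
    using add[of "i - a" "j - b"] by simp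
  show ?thesis
    unfolding hexmap_def
    by (intro sum.reindex_bij_witness[of _ "\<lambda>(i, j). (i + a, j + b)" "\<lambda>(i, j). (i - a, j - b)"])
       (auto simp: add diff diff_diff_eq2)
qed

lemma hexmap_periodic_eq:
  assumes "(a * n1 + b * n2) mod N = 0" "x' = x + of_int a" "y' = y + of_int b"
  shows "hexmap n1 n2 N r x' y' = hexmap n1 n2 N r x y"
  using hexmap_periodic[OF assms(1)] assms(2,3) by auto

text \<open>The origin and its six neighbours: the lattice points of hexagonal norm at most 1, the
  norm that \<open>hexhat\<close> subtracts from 1.\<close>

definition in_star :: "int \<Rightarrow> int \<Rightarrow> bool" where
  "in_star a b \<longleftrightarrow> \<bar>a\<bar> \<le> 1 \<and> \<bar>b\<bar> \<le> 1 \<and> \<bar>a - b\<bar> \<le> 1"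

definition star_injective :: "int \<Rightarrow> int \<Rightarrow> int \<Rightarrow> bool" where
  "star_injective n1 n2 N \<longleftrightarrow> (\<forall>a b a' b'. in_star a b \<longrightarrow> in_star a' b' \<longrightarrow>
     (a * n1 + b * n2) mod N = (a' * n1 + b' * n2) mod N \<longrightarrow> a = a' \<and> b = b')"

lemma star_injectiveD:
  assumes "star_injective n1 n2 N" "in_star a b" "in_star a' b'"
    and "(k + a * n1 + b * n2) mod N = (k + a' * n1 + b' * n2) mod N"
  shows "a = a' \<and> b = b'"
proof -
  have "(a * n1 + b * n2) mod N = (a' * n1 + b' * n2) mod N"
    using assms(4) by (simp add: mod_eq_dvd_iff algebra_simps)
  then show ?thesis
    using assms unfolding star_injective_def by blast
qed

text \<open>All vertices carrying weight at a point of the open star of (i, j) lie in the closed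
  star of (i, j), where labels are distinct. Hence a label collects at most one term of the
  sum.\<close>

lemma hexmap_on_star:
  assumes inj: "star_injective n1 n2 N" and hat: "hexhat (x - of_int i) (y - of_int j) \<noteq> 0"
    and ab: "in_star a b"
  shows "hexmap n1 n2 N r x y ((r + (i + a) * n1 + (j + b) * n2) mod N) =
    hexhat (x - of_int i - of_int a) (y - of_int j - of_int b)"
proof -
  have unique: "i' = i + a \<and> j' = j + b"
    if "hexhat (x - of_int i') (y - of_int j') \<noteq> 0"
      "(r + i' * n1 + j' * n2) mod N = (r + (i + a) * n1 + (j + b) * n2) mod N" for i' j'
  proof -
    have "\<bar>x - of_int i'\<bar> < 1" "\<bar>y - of_int j'\<bar> < 1" "\<bar>x - of_int i' - (y - of_int j')\<bar> < 1"
      "\<bar>x - of_int i\<bar> < 1" "\<bar>y - of_int j\<bar> < 1" "\<bar>x - of_int i - (y - of_int j)\<bar> < 1"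
      using that(1) hat by (auto simp: hexhat_nonzero_iff)
    then have "\<bar>real_of_int (i' - i)\<bar> < 2" "\<bar>real_of_int (j' - j)\<bar> < 2" "\<bar>real_of_int (i' - i - (j' - j))\<bar> < 2"
      unfolding of_int_diff by linarith+
    then have "in_star (i' - i) (j' - j)"
      unfolding in_star_def by linarith
    moreover have "((r + i * n1 + j * n2) + (i' - i) * n1 + (j' - j) * n2) mod N =
       ((r + i * n1 + j * n2) + a * n1 + b * n2) mod N"
      using that(2) by (simp add: algebra_simps)
    ultimately have "i' - i = a \<and> j' - j = b"
      using star_injectiveD[OF inj _ ab] by blast
    then show ?thesis
      by auto
  qed
  have "hexhat (x - of_int i') (y - of_int j') \<noteq> 0 \<and>
      (r + i' * n1 + j' * n2) mod N = (r + (i + a) * n1 + (j + b) * n2) mod N \<longleftrightarrow>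
      i' = i + a \<and> j' = j + b \<and> hexhat (x - of_int (i + a)) (y - of_int (j + b)) \<noteq> 0" for i' j'
    using unique by metis
  then have "{(i', j'). hexhat (x - of_int i') (y - of_int j') \<noteq> 0 \<and>
      (r + i' * n1 + j' * n2) mod N = (r + (i + a) * n1 + (j + b) * n2) mod N} =
    (if hexhat (x - of_int (i + a)) (y - of_int (j + b)) = 0 then {} else {(i + a, j + b)})"
    by (simp only:) auto
  then show ?thesis
    unfolding hexmap_def by (simp add: algebra_simps)
qed

text \<open>A common label of positive weight has a carrier near each of the two points. The weights
  on both stars agree, and \<open>hexhat_reconstruct\<close> turns them into equal offsets from the
  carriers. Allowing \<open>r\<close> and \<open>r'\<close> to differ makes this also separate the
  components.\<close>

lemma hexmap_eq_imp_congruent: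
  assumes inj: "star_injective n1 n2 N" and eq: "hexmap n1 n2 N r x y = hexmap n1 n2 N r' x' y'"
  obtains a b where "x = x' + of_int a" "y = y' + of_int b" "(r - r' + a * n1 + b * n2) mod N = 0"
proof -
  \<comment> \<open>The lower left corner of the unit square containing (x, y) always has positive
    weight.\<close>
  define i j where "i = \<lfloor>x\<rfloor>" and "j = \<lfloor>y\<rfloor>"
  have hat: "hexhat (x - of_int i) (y - of_int j) \<noteq> 0"
    unfolding hexhat_nonzero_iff i_def j_def by linarith
  let ?w = "(r + i * n1 + j * n2) mod N"
  have "hexmap n1 n2 N r x y ?w \<noteq> 0"
    using hexmap_on_star[OF inj hat, of 0 0] hat by (simp add: in_star_def)
  then have "hexmap n1 n2 N r' x' y' ?w \<noteq> 0"
    by (simp add: eq)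
  then obtain i' j' where hat': "hexhat (x' - of_int i') (y' - of_int j') \<noteq> 0"
    and w: "(r' + i' * n1 + j' * n2) mod N = ?w"
    unfolding hexmap_def by (elim sum.not_neutral_contains_not_neutral) auto
  have same: "hexhat (x - of_int i - of_int a) (y - of_int j - of_int b) =
      hexhat (x' - of_int i' - of_int a) (y' - of_int j' - of_int b)" if "in_star a b" for a b
  proof -
    have "(r + (i + a) * n1 + (j + b) * n2) mod N = (r' + (i' + a) * n1 + (j' + b) * n2) mod N"
      using w by (simp add: mod_eq_dvd_iff algebra_simps dvd_diff_commute)
    then show ?thesis
      using hexmap_on_star[OF inj hat that, of r] hexmap_on_star[OF inj hat' that, of r'] eq by simp
  qed
  note same' = same[of 1 0] same[of 1 1] same[of 0 1] same[of "-1" 0] same[of "-1" "-1"] same[of 0 "-1"]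
  have "x - of_int i = x' - of_int i'" "y - of_int j = y' - of_int j'"
    using hexhat_reconstruct[OF hat] hexhat_reconstruct[OF hat'] same' by (auto simp: in_star_def)
  moreover have "(r - r' + (i - i') * n1 + (j - j') * n2) mod N = 0"
  proof -
    have "N dvd (r + i * n1 + j * n2) - (r' + i' * n1 + j' * n2)"
      using w by (metis mod_eq_dvd_iff)
    then show ?thesis
      by (simp add: algebra_simps mod_eq_0_iff_dvd)
  qed
  ultimately show thesis
    by (intro that[of "i - i'" "j - j'"]) auto
qed

text \<open>Compactness bounds \<open>f\<close> and \<open>g\<close>, so finitely many vertices
  suffice for all points of \<open>K\<close> at once.\<close>

lemma continuous_on_hexmap:
  assumes "compact K" "continuous_on K f" "continuous_on K g"
  shows "continuous_on K (\<lambda>p. hexmap n1 n2 N r (f p) (g p) w)"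
proof -
  obtain a where a: "\<And>p. p \<in> K \<Longrightarrow> \<bar>f p\<bar> \<le> a"
    using compact_imp_bounded[OF compact_continuous_image[OF assms(2,1)]]
    by (auto simp: bounded_iff)
  obtain b where b: "\<And>p. p \<in> K \<Longrightarrow> \<bar>g p\<bar> \<le> b"
    using compact_imp_bounded[OF compact_continuous_image[OF assms(3,1)]]
    by (auto simp: bounded_iff)
  let ?B = "{- \<lceil>a\<rceil> - 1..\<lceil>a\<rceil> + 1} \<times> {- \<lceil>b\<rceil> - 1..\<lceil>b\<rceil> + 1}"
  have "hexmap n1 n2 N r (f p) (g p) w = (\<Sum>(i, j)\<in>?B.
      if (r + i * n1 + j * n2) mod N = w then hexhat (f p - of_int i) (g p - of_int j) else 0)"
    if "p \<in> K" for p
  proof (rule hexmap_eq_sum)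
    fix i j assume "hexhat (f p - of_int i) (g p - of_int j) \<noteq> 0"
    then have "\<bar>f p - of_int i\<bar> < 1" "\<bar>g p - of_int j\<bar> < 1"
      by (auto simp: hexhat_nonzero_iff)
    then have "\<bar>of_int i\<bar> < a + 1" "\<bar>of_int j\<bar> < b + 1"
      using a[OF that] b[OF that] by linarith+
    then show "(i, j) \<in> ?B"
      by (simp add: abs_less_iff) linarith
  qed simp
  moreover have "continuous_on K (\<lambda>p. \<Sum>(i, j)\<in>?B.
      if (r + i * n1 + j * n2) mod N = w then hexhat (f p - of_int i) (g p - of_int j) else 0)"
  proof (intro continuous_on_sum, clarify)
    fix i j
    show "continuous_on K (\<lambda>p. if (r + i * n1 + j * n2) mod N = w then hexhat (f p - of_int i) (g p - of_int j) else 0)"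
      by (cases "(r + i * n1 + j * n2) mod N = w"; simp add: hexhat_def)
         (intro continuous_intros assms)
  qed
  ultimately show ?thesis
    by (simp cong: continuous_on_cong)
qed

text \<open>The basis (q, s), (0, m) is the Hermite normal form of the relation lattice.\<close>
lemma relation_lattice_basis:
  fixes n1 n2 N :: int
  assumes "N > 0"
  obtains q s m where "q > 0" "m > 0"
    "\<And>a b. (a * n1 + b * n2) mod N = 0 \<longleftrightarrow> (\<exists>z t. a = z * q \<and> b = z * s + t * m)"
proof -
  \<comment> \<open>\<open>g\<close> generates the multiples of n2 modulo N and \<open>m\<close> is
    the order of n2; \<open>q\<close> is the least positive multiplier that brings n1 into this
    subgroup.\<close>
  define g where "g = gcd n2 N"
  define m where "m = N div g"
  define q where "q = g div gcd n1 g"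
  have g: "g > 0"
    using assms by (simp add: g_def)
  then have "gcd n1 g > 0"
    by simp
  have N: "N = g * m"
    by (simp add: m_def g_def)
  then have m: "m > 0"
    using assms g by (simp add: zero_less_mult_iff)
  have gq: "g = gcd n1 g * q"
    by (simp add: q_def)
  then have q: "q > 0"
    using g \<open>gcd n1 g > 0\<close> by (metis zero_less_mult_pos)
  obtain c where c: "n1 = gcd n1 g * c"
    by (meson dvdE gcd_dvd1)
  have q_dvd: "q dvd a" if "g dvd a * n1" for a
  proof -
    have "gcd (gcd n1 g * c) (gcd n1 g * q) = gcd n1 g"
      using c gq by simp
    then have "coprime c q"
      using g by (simp add: gcd_mult_distrib_int[symmetric] coprime_iff_gcd_eq_1)
    moreover have "gcd n1 g * q dvd gcd n1 g * (a * c)"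
      using that c gq by (simp add: mult.left_commute)
    then have "q dvd a * c"
      using g by simp
    ultimately show ?thesis
      by (simp add: coprime_commute coprime_dvd_mult_left_iff)
  qed
  have "q * n1 = q * (gcd n1 g * c)"
    by (rule arg_cong[OF c])
  also have "\<dots> = (gcd n1 g * q) * c"
    by (simp only: mult_ac)
  also have "\<dots> = g * c"
    by (simp only: gq[symmetric])
  finally have qn1: "q * n1 = g * c" .
  obtain u v where uv: "u * n2 + v * N = g"
    using bezout_int[of n2 N] unfolding g_def by auto
  \<comment> \<open>Since q n1 = g c and g is congruent to u n2, adding -c u copies of n2 cancels q
    copies of n1 modulo N.\<close>
  define s where "s = - c * u"
  have "q * n1 + s * n2 = c * v * N"
    unfolding qn1 uv[symmetric] by (simp add: s_def algebra_simps)
  then have s: "(q * n1 + s * n2) mod N = 0"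
    by simp
  have m_iff: "(t * n2) mod N = 0 \<longleftrightarrow> m dvd t" for t
  proof -
    obtain n2' where n2': "n2 = g * n2'"
      unfolding g_def by (meson dvdE gcd_dvd1)
    have "gcd n2 N = g"
      by (simp add: g_def)
    then have "gcd (g * n2') (g * m) = g"
      by (simp only: n2'[symmetric] N[symmetric])
    then have "coprime n2' m"
      using g by (simp add: gcd_mult_distrib_int[symmetric] coprime_iff_gcd_eq_1)
    have "(t * n2) mod N = 0 \<longleftrightarrow> g * m dvd g * (t * n2')"
      using n2' N by (simp add: mod_eq_0_iff_dvd mult.left_commute)
    also have "\<dots> \<longleftrightarrow> m dvd t"
      using g \<open>coprime n2' m\<close> by (simp add: coprime_commute coprime_dvd_mult_left_iff)
    finally show ?thesis .
  qed
  have shift: "(z * q * n1 + b * n2) mod N = ((b - z * s) * n2) mod N" for z b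
  proof -
    have "z * q * n1 + b * n2 = z * (q * n1 + s * n2) + (b - z * s) * n2"
      by (simp add: algebra_simps)
    moreover have "N dvd z * (q * n1 + s * n2)"
      using s by (simp add: mod_eq_0_iff_dvd)
    ultimately show ?thesis
      by (simp add: mod_eq_dvd_iff)
  qed
  have "(a * n1 + b * n2) mod N = 0 \<longleftrightarrow> (\<exists>z t. a = z * q \<and> b = z * s + t * m)" for a b
  proof
    assume *: "(a * n1 + b * n2) mod N = 0"
    then have "g dvd a * n1 + b * n2"
      using N by (metis dvd_trans dvd_triv_left mod_eq_0_iff_dvd)
    moreover have "g dvd b * n2"
      by (simp add: g_def)
    ultimately have "g dvd a * n1"
      by (simp add: dvd_add_left_iff)
    then obtain z where z: "a = z * q"
      using q_dvd by (metis dvdE mult.commute)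
    then have "m dvd b - z * s"
      using * shift m_iff by metis
    then obtain t where "b - z * s = m * t" ..
    then show "\<exists>z t. a = z * q \<and> b = z * s + t * m"
      using z by (intro exI[of _ z] exI[of _ t]) (simp add: algebra_simps)
  next
    assume "\<exists>z t. a = z * q \<and> b = z * s + t * m"
    then obtain z t where "a = z * q" "b = z * s + t * m"
      by blast
    moreover from this have "b - z * s = t * m"
      by simp
    ultimately show "(a * n1 + b * n2) mod N = 0"
      using shift m_iff by (metis dvd_triv_right)
  qed
  then show thesis
    by (rule that[OF q m])
qed

section \<open>Quotients of the plane are tori\<close>

lemma star_injective_swap: "star_injective n1 n2 N \<Longrightarrow> star_injective n2 n1 N"
  unfolding star_injective_def in_star_def by (metis abs_minus_commute add.commute)

lemma star_injective_triangle:
  assumes "star_injective n1 n2 N"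
  shows "distinct [k mod N, (k + n1) mod N, (k + n1 + n2) mod N]"
  using star_injectiveD[OF assms, of 0 0 1 0 k] star_injectiveD[OF assms, of 0 0 1 1 k]
    star_injectiveD[OF assms, of 1 0 1 1 k]
  by (auto simp: in_star_def)

text \<open>The condition on fractional parts selects the half square with corners (0,0), (1,0),
  (1,1), where the weights are \<open>1 - frac x\<close>, \<open>frac x - frac y\<close> and
  \<open>frac y\<close>.\<close>

lemma hexmap_in_geom_realization_upper:
  assumes inj: "star_injective n1 n2 N"
    and K: "\<And>k. {k mod N, (k + n1) mod N, (k + n1 + n2) mod N} \<in> K"
    and "frac y \<le> frac x"
  shows "hexmap n1 n2 N r x y \<in> geom_realization_set K"
proof -
  define k where "k = r + \<lfloor>x\<rfloor> * n1 + \<lfloor>y\<rfloor> * n2"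
  have xy: "x = of_int \<lfloor>x\<rfloor> + (frac x - frac y) + frac y" "y = of_int \<lfloor>y\<rfloor> + frac y"
    by (simp_all add: frac_def)
  have fr: "frac x < 1" "0 \<le> frac y"
    by (simp_all add: frac_lt_1)
  have eq: "hexmap n1 n2 N r x y w = (if k mod N = w then 1 - (frac x - frac y) - frac y else 0)
     + (if (k + n1) mod N = w then frac x - frac y else 0)
     + (if (k + n1 + n2) mod N = w then frac y else 0)" for w
    by (subst xy(1), subst xy(2), subst hexmap_upper_triangle)
       (use assms fr in \<open>simp_all add: k_def algebra_simps\<close>)
  show ?thesis
    using star_injective_triangle[OF inj, of k] fr assms(3)
    by (intro geom_realization_setI[OF K[of k], of "{k mod N, (k + n1) mod N, (k + n1 + n2) mod N}"])
       (auto simp: eq)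
qed

lemma hexmap_in_geom_realization:
  assumes inj: "star_injective n1 n2 N"
    and K: "\<And>k. {k mod N, (k + n1) mod N, (k + n1 + n2) mod N} \<in> K"
      "\<And>k. {k mod N, (k + n2) mod N, (k + n1 + n2) mod N} \<in> K"
  shows "hexmap n1 n2 N r x y \<in> geom_realization_set K"
proof (cases "frac y \<le> frac x")
  case True
  then show ?thesis
    using hexmap_in_geom_realization_upper[OF inj K(1)] by blast
next
  case False
  have "{k mod N, (k + n2) mod N, (k + n2 + n1) mod N} \<in> K" for k
    using K(2)[of k] by (simp add: algebra_simps)
  then have "hexmap n2 n1 N r y x \<in> geom_realization_set K"
    using False by (intro hexmap_in_geom_realization_upper star_injective_swap[OF inj]) auto
  moreover have "hexmap n2 n1 N r y x = hexmap n1 n2 N r x y"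
    using hexmap_swap by blast
  ultimately show ?thesis
    by simp
qed

text \<open>The values of \<open>f\<close> are barycentric coordinates and locate the preimage
  directly, in the triangle at any lattice vertex (i, j) labelled \<open>k\<close>.\<close>

lemma hexmap_onto_triangle:
  assumes inj: "star_injective n1 n2 N" and k: "(r + i * n1 + j * n2) mod N = k mod N"
    and f: "\<And>w. w \<notin> {k mod N, (k + n1) mod N, (k + n1 + n2) mod N} \<Longrightarrow> f w = 0" "\<And>w. f w \<ge> 0"
      "sum f {k mod N, (k + n1) mod N, (k + n1 + n2) mod N} = 1"
  obtains x y where "hexmap n1 n2 N r x y = f"
proof -
  let ?c1 = "f ((k + n1) mod N)" and ?c2 = "f ((k + n1 + n2) mod N)"
  have dist: "distinct [k mod N, (k + n1) mod N, (k + n1 + n2) mod N]"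
    by (rule star_injective_triangle[OF inj])
  then have sum: "f (k mod N) = 1 - ?c1 - ?c2"
    using f(3) by simp
  have labels: "(r + (i + 1) * n1 + j * n2) mod N = (k + n1) mod N"
    "(r + (i + 1) * n1 + (j + 1) * n2) mod N = (k + n1 + n2) mod N"
    using k by (auto simp: mod_eq_dvd_iff algebra_simps)
  have "hexmap n1 n2 N r (of_int i + ?c1 + ?c2) (of_int j + ?c2) w = f w" for w
  proof -
    have "?c1 + ?c2 \<le> 1"
      using sum f(2)[of "k mod N"] by simp
    then show ?thesis
      using dist f(1)[of w] sum by (subst hexmap_upper_triangle) (auto simp: f(2) k labels)
  qed
  then show thesis
    by (intro that ext)
qed

lemma torus_space_eq: "torus_space = top_of_set (sphere 0 1 \<times> sphere 0 1)"
  by (simp add: torus_space_def)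

lemma cis_2pi_eq_iff: "cis (2 * pi * a) = cis (2 * pi * b) \<longleftrightarrow> (\<exists>n::int. a = b + of_int n)"
proof -
  have "cis (2 * pi * a) = cis (2 * pi * b) \<longleftrightarrow> (\<exists>n::int. 2 * pi * a = 2 * pi * b + 2 * pi * n)"
    using sin_cos_eq_iff[of "2 * pi * a" "2 * pi * b"] by (auto simp: complex_eq_iff)
  also have "\<dots> \<longleftrightarrow> (\<exists>n::int. a = b + of_int n)"
    by (simp flip: distrib_left)
  finally show ?thesis .
qed

lemma cis_2pi_surj:
  assumes "z \<in> sphere 0 1"
  obtains a where "0 \<le> a" "a \<le> 1" "z = cis (2 * pi * a)"
proof -
  have "z = cis (Arg2pi z)"
    using assms Arg2pi_eq[of z] by (simp add: cis_conv_exp)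
  then show thesis
    using Arg2pi[of z] by (intro that[of "Arg2pi z / (2 * pi)"]) auto
qed

lemma torus_space_cisE:
  assumes "p \<in> topspace torus_space"
  obtains a b where "p = (cis (2 * pi * a), cis (2 * pi * b))" "(a, b) \<in> {0..1} \<times> {0..1}"
proof -
  have p: "fst p \<in> sphere 0 1" "snd p \<in> sphere 0 1"
    using assms by (auto simp: torus_space_eq)
  obtain a where a: "0 \<le> a" "a \<le> 1" "fst p = cis (2 * pi * a)"
    using p(1) by (rule cis_2pi_surj)
  obtain b where b: "0 \<le> b" "b \<le> 1" "snd p = cis (2 * pi * b)"
    using p(2) by (rule cis_2pi_surj)
  show thesis
    using a b by (intro that[of a b]) (auto simp: prod_eq_iff)
qed

text \<open>Both end points are kept so that the square is compact; a continuous surjection onto a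
  Hausdorff space is then a quotient map.\<close>

lemma quotient_map_square_torus:
  "quotient_map (top_of_set ({0..1} \<times> {0..1})) torus_space (\<lambda>(a, b). (cis (2 * pi * a), cis (2 * pi * b)))"
proof (rule T1_Spaces.continuous_imp_quotient_map)
  show "continuous_map (top_of_set ({0..1} \<times> {0..1})) torus_space (\<lambda>(a, b). (cis (2 * pi * a), cis (2 * pi * b)))"
    by (auto simp: torus_space_eq continuous_map_in_subtopology case_prod_unfold intro!: continuous_intros)
  show "compact_space (top_of_set ({0..1 :: real} \<times> {0..1 :: real}))"
    by (simp add: compact_space_subtopology compact_Times)
  show "Hausdorff_space torus_space"
    by (simp add: torus_space_eq Hausdorff_space_subtopology)
  show "(\<lambda>(a, b). (cis (2 * pi * a), cis (2 * pi * b))) ` topspace (top_of_set ({0..1} \<times> {0..1})) =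
     topspace torus_space"
  proof
    show "topspace torus_space \<subseteq>
      (\<lambda>(a, b). (cis (2 * pi * a), cis (2 * pi * b))) ` topspace (top_of_set ({0..1} \<times> {0..1}))"
    proof
      fix p :: "complex \<times> complex" assume "p \<in> topspace torus_space"
      then obtain a b where "p = (cis (2 * pi * a), cis (2 * pi * b))" "(a, b) \<in> {0..1} \<times> {0..1}"
        by (rule torus_space_cisE)
      then show "p \<in> (\<lambda>(a, b). (cis (2 * pi * a), cis (2 * pi * b))) ` topspace (top_of_set ({0..1} \<times> {0..1}))"
        by (intro image_eqI[of _ _ "(a, b)"]) auto
    qed
  qed (auto simp: torus_space_eq)
qed

text \<open>(a, b) are coordinates in the basis (q, s), (0, m). Integer shifts of them are
  translations by relations, under which \<open>hexmap\<close> is invariant, so it descends to the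
  torus.\<close>

lemma hexmap_factors_through_torus:
  fixes q s m :: int
  assumes inj: "star_injective n1 n2 N"
    and K: "\<And>k. {k mod N, (k + n1) mod N, (k + n1 + n2) mod N} \<in> K"
      "\<And>k. {k mod N, (k + n2) mod N, (k + n1 + n2) mod N} \<in> K"
    and basis: "\<And>a b. (a * n1 + b * n2) mod N = 0 \<longleftrightarrow> (\<exists>z t. a = z * q \<and> b = z * s + t * m)"
  obtains g where "continuous_map torus_space (geom_realization K) g"
    "\<And>a b. g (cis (2 * pi * a), cis (2 * pi * b)) = hexmap n1 n2 N r (a * of_int q) (a * of_int s + b * of_int m)"
proof -
  let ?Q = "{0..1 :: real} \<times> {0..1 :: real}"
  define F where "F = (\<lambda>(a, b). hexmap n1 n2 N r (a * of_int q) (a * of_int s + b * of_int m))"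
  have periodic: "F (a + of_int z, b + of_int t) = F (a, b)" for a b z t
  proof -
    have "(z * q * n1 + (z * s + t * m) * n2) mod N = 0"
      using basis by blast
    then show ?thesis
      unfolding F_def prod.case by (rule hexmap_periodic_eq) (simp_all add: algebra_simps)
  qed
  have F_cis: "F (a, b) = F (a', b')"
    if eq: "cis (2 * pi * a) = cis (2 * pi * a')" "cis (2 * pi * b) = cis (2 * pi * b')" for a b a' b'
  proof -
    obtain z t :: int where "a = a' + of_int z" "b = b' + of_int t"
      using eq unfolding cis_2pi_eq_iff by blast
    then show ?thesis
      by (simp add: periodic)
  qed
  have "continuous_map (top_of_set ?Q) (geom_realization K) F"
    unfolding continuous_map_geom_realization_iff
  proof (intro conjI allI)
    show "F \<in> topspace (top_of_set ?Q) \<rightarrow> geom_realization_set K"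
      using hexmap_in_geom_realization[OF inj K] by (auto simp: F_def)
    fix w
    have "continuous_on ?Q (\<lambda>p. hexmap n1 n2 N r (fst p * of_int q) (fst p * of_int s + snd p * of_int m) w)"
      by (intro continuous_on_hexmap continuous_intros) (simp add: compact_Times)
    then show "continuous_map (top_of_set ?Q) euclideanreal (\<lambda>p. F p w)"
      by (simp add: F_def case_prod_unfold)
  qed
  moreover have "F p = F p'"
    if "(\<lambda>(a, b). (cis (2 * pi * a), cis (2 * pi * b))) p = (\<lambda>(a, b). (cis (2 * pi * a), cis (2 * pi * b))) p'" for p p'
    using that F_cis[of "fst p" "fst p'" "snd p" "snd p'"] by (simp add: case_prod_unfold)
  ultimately obtain g where g: "continuous_map torus_space (geom_realization K) g"
    "\<And>p. p \<in> ?Q \<Longrightarrow> g ((\<lambda>(a, b). (cis (2 * pi * a), cis (2 * pi * b))) p) = F p"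
    by (rule quotient_map_lift_exists[OF quotient_map_square_torus]) auto
  have "g (cis (2 * pi * a), cis (2 * pi * b)) = F (a, b)" for a b
  proof -
    \<comment> \<open>The lift is known only on the unit square; fractional parts reduce all
      parameters to it.\<close>
    have red: "cis (2 * pi * x) = cis (2 * pi * frac x)" for x
      unfolding cis_2pi_eq_iff by (intro exI[of _ "\<lfloor>x\<rfloor>"]) (simp add: frac_def)
    have "(frac a, frac b) \<in> ?Q"
      by (simp add: less_imp_le[OF frac_lt_1])
    then have "g (cis (2 * pi * frac a), cis (2 * pi * frac b)) = F (frac a, frac b)"
      using g(2)[of "(frac a, frac b)"] by simp
    then show ?thesis
      using F_cis[OF red[of a] red[of b]] by (simp flip: red)
  qed
  then show thesis
    using that[OF g(1)] by (simp add: F_def)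
qed

text \<open>The labels r + i n1 + j n2 modulo N fill the residue class of r modulo gcd(n1, n2, N).
  Each class thus carries one torus, indexed by its least nonnegative member.\<close>

lemma geom_realization_homeomorphic_tori:
  assumes "N > 0" and inj: "star_injective n1 n2 N"
    and K: "\<And>k. {k mod N, (k + n1) mod N, (k + n1 + n2) mod N} \<in> K"
      "\<And>k. {k mod N, (k + n2) mod N, (k + n1 + n2) mod N} \<in> K"
    and cover: "\<And>f. f \<in> geom_realization_set K \<Longrightarrow> (\<forall>w. f w \<ge> 0) \<and>
       (\<exists>k. \<exists>\<tau>\<in>{{k mod N, (k + n1) mod N, (k + n1 + n2) mod N}, {k mod N, (k + n2) mod N, (k + n1 + n2) mod N}}.
          (\<forall>w. w \<notin> \<tau> \<longrightarrow> f w = 0) \<and> sum f \<tau> = 1)"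
    and "Hausdorff_space (geom_realization K)"
  shows "\<exists>I :: nat set. geom_realization K homeomorphic_space sum_topology (\<lambda>i. torus_space) I"
proof -
  obtain q s m where qm: "q > 0" "m > 0"
    and basis: "\<And>a b. (a * n1 + b * n2) mod N = 0 \<longleftrightarrow> (\<exists>z t. a = z * q \<and> b = z * s + t * m)"
    using relation_lattice_basis[OF \<open>N > 0\<close>] by metis
  have "\<exists>g. \<forall>r. continuous_map torus_space (geom_realization K) (g r) \<and>
    (\<forall>a b. g r (cis (2 * pi * a), cis (2 * pi * b)) =
       hexmap n1 n2 N (int r) (a * of_int q) (a * of_int s + b * of_int m))"
    by (rule choice) (metis hexmap_factors_through_torus[OF inj K basis])
  then obtain g where g: "\<And>r. continuous_map torus_space (geom_realization K) (g r)"
    and gF: "\<And>r a b. g r (cis (2 * pi * a), cis (2 * pi * b)) =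
       hexmap n1 n2 N (int r) (a * of_int q) (a * of_int s + b * of_int m)"
    by blast
  define d where "d = gcd n1 (gcd n2 N)"
  have "d dvd gcd n2 N"
    unfolding d_def by (rule gcd_dvd2)
  then have "d dvd n2" "d dvd N"
    by simp_all
  moreover have "d > 0" "d dvd n1"
    using \<open>N > 0\<close> by (simp_all add: d_def)
  ultimately have d: "d > 0" "d dvd n1" "d dvd n2" "d dvd N"
    by blast+
  have "geom_realization K homeomorphic_space sum_topology (\<lambda>i. torus_space) {..<nat d}"
  proof (rule homeomorphic_space_sum_topologyI[of _ _ _ g])
    fix i j y z
    assume ij: "i \<in> {..<nat d}" "j \<in> {..<nat d}" and yz: "y \<in> topspace torus_space" "z \<in> topspace torus_space"
      and eq: "g i y = g j z"
    obtain a b where y: "y = (cis (2 * pi * a), cis (2 * pi * b))"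
      using yz(1) by (rule torus_space_cisE)
    obtain a' b' where z: "z = (cis (2 * pi * a'), cis (2 * pi * b'))"
      using yz(2) by (rule torus_space_cisE)
    obtain u v where uv: "a * of_int q = a' * of_int q + of_int u"
      "a * of_int s + b * of_int m = a' * of_int s + b' * of_int m + of_int v"
      and cong: "(int i - int j + u * n1 + v * n2) mod N = 0"
      using hexmap_eq_imp_congruent[OF inj eq[unfolded y z gF]] by metis
    have "d dvd int i - int j + u * n1 + v * n2"
      using cong d by (meson dvd_trans mod_eq_0_iff_dvd)
    then have "d dvd int i - int j + (u * n1 + v * n2)"
      by (simp add: add.assoc)
    moreover have "d dvd u * n1 + v * n2"
      using d by auto
    ultimately have "d dvd int i - int j"
      using dvd_add_left_iff by blast
    moreover have "\<bar>int i - int j\<bar> < d"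
      using ij by auto
    ultimately have "int i - int j = 0"
      using dvd_imp_le_int[of "int i - int j" d] d by auto
    then have "i = j"
      by simp
    \<comment> \<open>With equal base labels (u, v) is itself a relation, so \<open>a\<close> and
      \<open>b\<close> change by integers, which \<open>cis\<close> does not see.\<close>
    with cong have "(u * n1 + v * n2) mod N = 0"
      by simp
    then obtain c t where ct: "u = c * q" "v = c * s + t * m"
      unfolding basis by (elim exE conjE)
    have a: "a = a' + of_int c"
    proof -
      have "a * of_int q = (a' + of_int c) * of_int q"
        using uv(1) ct by (simp add: algebra_simps)
      then show ?thesis
        using qm by simp
    qed
    have "b * of_int m = (b' + of_int t) * of_int m"
      using uv(2) ct by (simp add: a algebra_simps)
    then have "b = b' + of_int t"
      using qm by simp
    with a have "y = z"
      by (simp add: y z cis_2pi_eq_iff)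
    with \<open>i = j\<close> show "i = j \<and> y = z" ..
  next
    fix f assume "f \<in> topspace (geom_realization K)"
    then obtain k \<tau> where nonneg: "\<And>w. f w \<ge> 0" and \<tau>: "\<tau> \<in> {{k mod N, (k + n1) mod N, (k + n1 + n2) mod N},
        {k mod N, (k + n2) mod N, (k + n1 + n2) mod N}}"
      and f: "\<And>w. w \<notin> \<tau> \<Longrightarrow> f w = 0" "sum f \<tau> = 1"
      using cover[of f] by auto
    define r where "r = nat (k mod d)"
    have r: "int r = k mod d" "r < nat d"
      using d by (auto simp: r_def nat_less_eq_zless)
    \<comment> \<open>Two Bezout identities express d, hence the difference of \<open>k\<close> and
      \<open>r\<close>, through n1, n2 and N; this yields a lattice vertex labelled
      \<open>k\<close>.\<close>
    obtain u v u' v' where "u * n2 + v * N = gcd n2 N" "u' * n1 + v' * gcd n2 N = d"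
      using bezout_int[of n2 N] bezout_int[of n1 "gcd n2 N"] unfolding d_def by blast
    then have "d = u' * n1 + v' * u * n2 + v' * v * N"
      by (simp add: algebra_simps flip: \<open>u * n2 + v * N = gcd n2 N\<close>)
    moreover have "k = int r + (k div d) * d"
      by (simp add: r)
    ultimately have "k = int r + (k div d * u') * n1 + (k div d * (v' * u)) * n2 + (k div d * (v' * v)) * N"
      by (metis (no_types, opaque_lifting) add.assoc distrib_left mult.assoc)
    then obtain i j where k: "(int r + i * n1 + j * n2) mod N = k mod N"
      by (metis mod_mult_self1)
    obtain x y where xy: "hexmap n1 n2 N (int r) x y = f"
    proof (cases "\<tau> = {k mod N, (k + n1) mod N, (k + n1 + n2) mod N}")
      case True
      then show thesis
        using hexmap_onto_triangle[OF inj k, of f] f nonneg that by metis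
    next
      case False
      then have \<tau>': "\<tau> = {k mod N, (k + n2) mod N, (k + n2 + n1) mod N}"
        using \<tau> by (simp add: algebra_simps)
      have "(int r + j * n2 + i * n1) mod N = k mod N"
        using k by (simp add: algebra_simps)
      then obtain x y where "hexmap n2 n1 N (int r) x y = f"
        using hexmap_onto_triangle[OF star_injective_swap[OF inj], of "int r" j i k f] f nonneg \<tau>' by metis
      then show thesis
        using that[of y x] hexmap_swap[of n1 n2 N "int r" y x] by auto
    qed
    \<comment> \<open>Solves x = a q and y = a s + b m.\<close>
    define a where "a = x / of_int q"
    define b where "b = (y - a * of_int s) / of_int m"
    have "f = g r (cis (2 * pi * a), cis (2 * pi * b))"
      unfolding gF using qm xy by (simp add: a_def b_def)
    then show "\<exists>i\<in>{..<nat d}. \<exists>y\<in>topspace torus_space. g i y = f"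
      using r(2) by (intro bexI[of _ r] bexI[of _ "(cis (2 * pi * a), cis (2 * pi * b))"])
        (auto simp: torus_space_eq)
  next
    show "compact_space torus_space"
      by (simp add: torus_space_eq compact_space_subtopology compact_Times)
  qed (use g assms in auto)
  then show ?thesis
    by blast
qed

section \<open>Tetrahedra\<close>

text \<open>Compact convex sets of equal dimension have homeomorphic relative frontiers; here they
  are the standard simplex and the ball. The last alternative is the face where the implicit fourth
  barycentric coordinate, 1 minus the sum, vanishes.\<close>

lemma simplex_boundary_homeomorphic_sphere:
  "{x :: real^3. (\<forall>i. 0 \<le> x $ i) \<and> (\<Sum>i\<in>UNIV. x $ i) \<le> 1 \<and> ((\<exists>i. x $ i = 0) \<or> (\<Sum>i\<in>UNIV. x $ i) = 1)}
     homeomorphic sphere (0 :: real^3) 1"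
proof -
  let ?S = "convex hull (insert 0 Basis) :: (real^3) set"
  have Basis: "Basis = range (\<lambda>i. axis i 1 :: real^3)"
    by (auto simp: Basis_vec_def)
  have inner: "x \<bullet> axis i 1 = x $ i" for x :: "real^3" and i
    by (simp add: inner_axis)
  have sum: "(\<Sum>b\<in>Basis. x \<bullet> b) = (\<Sum>i\<in>UNIV. x $ i)" for x :: "real^3"
    unfolding Basis by (subst sum.reindex) (auto simp: inj_on_def axis_eq_axis inner)
  have S: "?S = {x. (\<forall>i. 0 \<le> x $ i) \<and> (\<Sum>i\<in>UNIV. x $ i) \<le> 1}"
    unfolding std_simplex sum by (simp add: Basis inner)
  have int: "interior ?S = {x. (\<forall>i. 0 < x $ i) \<and> (\<Sum>i\<in>UNIV. x $ i) < 1}"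
    unfolding interior_std_simplex sum by (simp add: Basis inner)
  have ne: "interior ?S \<noteq> {}"
    using interior_std_simplex_nonempty by blast
  have comp: "compact ?S"
    by (simp add: compact_convex_hull finite_imp_compact)
  have "rel_frontier ?S = frontier ?S"
    using ne affine_hull_nonempty_interior rel_frontier_frontier by blast
  also have "\<dots> = ?S - interior ?S"
    using comp by (simp add: frontier_def compact_imp_closed closure_closed)
  also have "\<dots> = {x. (\<forall>i. 0 \<le> x $ i) \<and> (\<Sum>i\<in>UNIV. x $ i) \<le> 1 \<and> ((\<exists>i. x $ i = 0) \<or> (\<Sum>i\<in>UNIV. x $ i) = 1)}"
    unfolding int unfolding S by (auto simp: less_le)
  finally have eq: "rel_frontier ?S = \<dots>" .
  have "aff_dim ?S = aff_dim (cball (0 :: real^3) 1)"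
    using ne by (simp add: aff_dim_nonempty_interior)
  then have "rel_frontier ?S homeomorphic rel_frontier (cball (0 :: real^3) 1)"
    using comp by (intro homeomorphic_rel_frontiers_convex_bounded_sets) (auto intro: compact_imp_bounded)
  then show ?thesis
    by (simp add: eq)
qed

text \<open>A triangle of step a stays in one residue class modulo a. The class has four members
  modulo 4a and the triangle omits just one, so each of the a classes spans the boundary of a
  tetrahedron.\<close>

lemma geom_realization_homeomorphic_spheres:
  fixes a :: int
  assumes a: "a > 0"
    and K: "\<And>k. {k mod (4*a), (k + a) mod (4*a), (k + 2*a) mod (4*a)} \<in> K"
    and cover: "\<And>f. f \<in> geom_realization_set K \<Longrightarrow> (\<forall>w. f w \<ge> 0) \<and>
       (\<exists>k. (\<forall>w. w \<notin> {k mod (4*a), (k + a) mod (4*a), (k + 2*a) mod (4*a)} \<longrightarrow> f w = 0) \<and>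
          sum f {k mod (4*a), (k + a) mod (4*a), (k + 2*a) mod (4*a)} = 1)"
    and Hausdorff: "Hausdorff_space (geom_realization K)"
  shows "\<exists>I :: nat set. geom_realization K homeomorphic_space sum_topology (\<lambda>i. sphere2_space) I"
proof -
  define F where "F = {x :: real^3. (\<forall>i. 0 \<le> x $ i) \<and> (\<Sum>i\<in>UNIV. x $ i) \<le> 1 \<and>
     ((\<exists>i. x $ i = 0) \<or> (\<Sum>i\<in>UNIV. x $ i) = 1)}"
  have exists_3: "(\<exists>i::3. P i) \<longleftrightarrow> P 1 \<or> P 2 \<or> P 3" for P
    by (metis exhaust_3)
  have F_iff: "x \<in> F \<longleftrightarrow> 0 \<le> x$1 \<and> 0 \<le> x$2 \<and> 0 \<le> x$3 \<and> x$1 + x$2 + x$3 \<le> 1 \<and>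
     (x$1 = 0 \<or> x$2 = 0 \<or> x$3 = 0 \<or> x$1 + x$2 + x$3 = 1)" for x
    by (auto simp: F_def sum_3 forall_3 exists_3)
  obtain h h' where "homeomorphism F (sphere (0 :: real^3) 1) h' h"
    using simplex_boundary_homeomorphic_sphere[unfolded homeomorphic_def, folded F_def] by blast
  then have h: "homeomorphism (sphere (0 :: real^3) 1) F h h'"
    by (rule homeomorphism_symD)
  define e :: "int \<Rightarrow> real^3 \<Rightarrow> int \<Rightarrow> real" where
    "e r x w = (if w = r then 1 - x$1 - x$2 - x$3 else if w = r + a then x$1
       else if w = r + 2*a then x$2 else if w = r + 3*a then x$3 else 0)" for r x w
  define \<tau> where "\<tau> k = {k mod (4*a), (k + a) mod (4*a), (k + 2*a) mod (4*a)}" for k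
  have \<tau>: "\<tau> r = {r, r + a, r + 2*a}" "\<tau> (r + a) = {r + a, r + 2*a, r + 3*a}"
    "\<tau> (r + 2*a) = {r + 2*a, r + 3*a, r}" "\<tau> (r + 3*a) = {r + 3*a, r, r + a}" if "0 \<le> r" "r < a" for r
  proof -
    have low: "r mod (4*a) = r" "(r + a) mod (4*a) = r + a" "(r + 2*a) mod (4*a) = r + 2*a"
      "(r + 3*a) mod (4*a) = r + 3*a" "(r + a + a) mod (4*a) = r + 2*a" "(r + a + 2*a) mod (4*a) = r + 3*a"
      "(r + 2*a + a) mod (4*a) = r + 3*a"
      using that by (intro mod_eqI[of _ _ _ 0]; simp)+
    have high: "(r + 2*a + 2*a) mod (4*a) = r" "(r + 3*a + a) mod (4*a) = r" "(r + 3*a + 2*a) mod (4*a) = r + a"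
      using that by (intro mod_eqI[of _ _ _ 1]; simp)+
    show "\<tau> r = {r, r + a, r + 2*a}" "\<tau> (r + a) = {r + a, r + 2*a, r + 3*a}"
      "\<tau> (r + 2*a) = {r + 2*a, r + 3*a, r}" "\<tau> (r + 3*a) = {r + 3*a, r, r + a}"
      by (simp_all only: \<tau>_def low high)
  qed
  have e_in: "e r x \<in> geom_realization_set K" if r: "0 \<le> r" "r < a" and x: "x \<in> F" for r x
  proof -
    have tri: "e r x \<in> geom_realization_set K"
      if "\<And>w. w \<notin> \<tau> k \<Longrightarrow> e r x w = 0" "\<And>w. e r x w \<ge> 0" "sum (e r x) (\<tau> k) = 1" for k
      using that by (intro geom_realization_setI[of "\<tau> k" _ "\<tau> k"]) (auto simp: \<tau>_def K)
    have nonneg: "e r x w \<ge> 0" for w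
      using x by (auto simp: e_def F_iff)
    \<comment> \<open>Each alternative names the vertex of weight zero and so selects the opposite
      face; the first is the face opposite \<open>r\<close>.\<close>
    consider "x$1 + x$2 + x$3 = 1" | "x$1 = 0" | "x$2 = 0" | "x$3 = 0"
      using x F_iff by blast
    then show ?thesis
    proof cases
      case 1
      then show ?thesis
        using nonneg a by (intro tri[of "r + a"]) (auto simp: e_def \<tau>[OF r])
    next
      case 2
      then show ?thesis
        using nonneg a by (intro tri[of "r + 2*a"]) (auto simp: e_def \<tau>[OF r])
    next
      case 3
      then show ?thesis
        using nonneg a by (intro tri[of "r + 3*a"]) (auto simp: e_def \<tau>[OF r])
    next
      case 4
      then show ?thesis
        using nonneg a by (intro tri[of r]) (auto simp: e_def \<tau>[OF r])
    qed
  qed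
  have e_inj: "r = r' \<and> x = x'"
    if r: "0 \<le> r" "r < a" "0 \<le> r'" "r' < a" and eq: "e r x = e r' x'" for r r' x x'
  proof -
    have "\<exists>w. e r x w \<noteq> 0"
    proof (rule ccontr)
      assume "\<not> ?thesis"
      then have "e r x r = 0" "e r x (r + a) = 0" "e r x (r + 2*a) = 0" "e r x (r + 3*a) = 0"
        by auto
      then show False
        using a by (simp add: e_def)
    qed
    then obtain w where w: "e r x w \<noteq> 0" "e r' x' w \<noteq> 0"
      using eq by auto
    \<comment> \<open>The support lies in the class of \<open>r\<close> modulo \<open>a\<close>, so
      a single vertex of nonzero weight identifies the tetrahedron.\<close>
    have "w mod a = r" if "0 \<le> r" "r < a" "e r x w \<noteq> 0" for r x
    proof -
      have "w \<in> {r, r + a, r + 2*a, r + 3*a}"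
        using that(3) by (auto simp: e_def split: if_splits)
      then show ?thesis
        using that(1,2) by auto
    qed
    then have "r = r'"
      using r w by metis
    moreover from this have "e r x (r + a) = e r x' (r + a)" "e r x (r + 2*a) = e r x' (r + 2*a)"
      "e r x (r + 3*a) = e r x' (r + 3*a)"
      using eq by auto
    then have "x = x'"
      using a by (auto simp: e_def vec_eq_iff forall_3)
    ultimately show ?thesis ..
  qed
  have e_onto: "\<exists>r x. 0 \<le> r \<and> r < a \<and> x \<in> F \<and> e r x = f" if fK: "f \<in> geom_realization_set K" for f
  proof -
    obtain k where f: "\<And>w. f w \<ge> 0" "\<And>w. w \<notin> \<tau> k \<Longrightarrow> f w = 0" "sum f (\<tau> k) = 1"
      using cover[OF fK] unfolding \<tau>_def by blast
    \<comment> \<open>\<open>r\<close> names the tetrahedron, and \<open>c\<close> below the vertex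
      of it at which the triangle starts.\<close>
    define r where "r = k mod (4*a) mod a"
    have r: "0 \<le> r" "r < a"
      using a by (auto simp: r_def)
    define c where "c = k mod (4*a) div a"
    have k: "k mod (4*a) = r + c * a"
      by (simp add: r_def c_def)
    then have "c * a < 4 * a"
      using r pos_mod_bound[of "4*a" k] a by linarith
    then have "c < 4"
      using a by simp
    moreover have "0 \<le> c"
      using a by (simp add: c_def pos_imp_zdiv_nonneg_iff)
    ultimately have c: "c = 0 \<or> c = 1 \<or> c = 2 \<or> c = 3"
      by auto
    have "\<tau> k = \<tau> (k mod (4*a))"
      by (simp add: \<tau>_def mod_add_left_eq)
    then have "\<tau> k = \<tau> (r + c * a)"
      by (simp only: k)
    with c have \<tau>_cases: "\<tau> k = \<tau> r \<or> \<tau> k = \<tau> (r + a) \<or> \<tau> k = \<tau> (r + 2*a) \<or> \<tau> k = \<tau> (r + 3*a)"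
      by (elim disjE) simp_all
    have sup: "f w = 0" if "w \<notin> {r, r + a, r + 2*a, r + 3*a}" for w
      using \<tau>_cases that unfolding \<tau>[OF r] by (intro f(2)) auto
    have sum: "f r + f (r + a) + f (r + 2*a) + f (r + 3*a) = 1"
      and zero: "f r = 0 \<or> f (r + a) = 0 \<or> f (r + 2*a) = 0 \<or> f (r + 3*a) = 0"
    proof -
      have ne: "r \<noteq> r + a" "r \<noteq> r + 2*a" "r \<noteq> r + 3*a" "r + a \<noteq> r + 2*a" "r + a \<noteq> r + 3*a" "r + 2*a \<noteq> r + 3*a"
        using a by auto
      from \<tau>_cases have "f r + f (r + a) + f (r + 2*a) + f (r + 3*a) = 1 \<and>
        (f r = 0 \<or> f (r + a) = 0 \<or> f (r + 2*a) = 0 \<or> f (r + 3*a) = 0)"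
      proof (elim disjE)
        assume *: "\<tau> k = \<tau> r"
        show ?thesis
          using f(2)[of "r + 3*a"] f(3) ne unfolding * \<tau>[OF r] by simp
      next
        assume *: "\<tau> k = \<tau> (r + a)"
        show ?thesis
          using f(2)[of r] f(3) ne unfolding * \<tau>[OF r] by simp
      next
        assume *: "\<tau> k = \<tau> (r + 2*a)"
        show ?thesis
          using f(2)[of "r + a"] f(3) ne unfolding * \<tau>[OF r] by simp
      next
        assume *: "\<tau> k = \<tau> (r + 3*a)"
        show ?thesis
          using f(2)[of "r + 2*a"] f(3) ne unfolding * \<tau>[OF r] by simp
      qed
      then show "f r + f (r + a) + f (r + 2*a) + f (r + 3*a) = 1"
        "f r = 0 \<or> f (r + a) = 0 \<or> f (r + 2*a) = 0 \<or> f (r + 3*a) = 0"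
        by blast+
    qed
    define x :: "real^3" where "x = vector [f (r + a), f (r + 2*a), f (r + 3*a)]"
    have x: "x$1 = f (r + a)" "x$2 = f (r + 2*a)" "x$3 = f (r + 3*a)"
      by (simp_all add: x_def)
    have "x \<in> F"
      unfolding F_iff x using sum zero f(1)[of r] f(1)[of "r + a"] f(1)[of "r + 2*a"] f(1)[of "r + 3*a"] by auto
    moreover have "e r x w = f w" for w
      using sum sup[of w] by (simp add: e_def x)
    ultimately show ?thesis
      using r by blast
  qed
  have "geom_realization K homeomorphic_space sum_topology (\<lambda>i. sphere2_space) {..<nat a}"
  proof (rule homeomorphic_space_sum_topologyI[of _ _ _ "\<lambda>r. e (int r) \<circ> h"])
    fix r assume "r \<in> {..<nat a}"
    then have r: "0 \<le> int r" "int r < a"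
      by auto
    have "continuous_on (sphere 0 1) h"
      using h homeomorphism_cont1 by blast
    then have coord: "continuous_on (sphere 0 1) (\<lambda>y. h y $ i)" for i
      by (rule continuous_on_component)
    have "continuous_on (sphere 0 1) (\<lambda>y. e (int r) (h y) w)" for w
      unfolding e_def
      by (cases "w = int r"; cases "w = int r + a"; cases "w = int r + 2*a"; cases "w = int r + 3*a"; simp add: coord)
         (intro continuous_on_diff continuous_on_const coord)+
    moreover have "h y \<in> F" if "y \<in> sphere 0 1" for y
      using h that by (auto simp: homeomorphism_def)
    ultimately show "continuous_map sphere2_space (geom_realization K) (e (int r) \<circ> h)"
      using e_in[OF r] by (auto simp: continuous_map_geom_realization_iff sphere2_space_def)
  next
    fix i j y z
    assume "i \<in> {..<nat a}" "j \<in> {..<nat a}" and yz: "y \<in> topspace sphere2_space" "z \<in> topspace sphere2_space"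
      and eq: "(e (int i) \<circ> h) y = (e (int j) \<circ> h) z"
    then have "int i = int j \<and> h y = h z"
      by (intro e_inj) auto
    then show "i = j \<and> y = z"
      using h yz by (metis homeomorphism_apply1 of_nat_eq_iff sphere2_space_def topspace_euclidean_subtopology)
  next
    fix f assume "f \<in> topspace (geom_realization K)"
    then obtain r x where rx: "0 \<le> r" "r < a" "x \<in> F" "e r x = f"
      using e_onto[of f] by auto
    then have "h' x \<in> sphere 0 1" "h (h' x) = x"
      using h by (auto simp: homeomorphism_def)
    then show "\<exists>i\<in>{..<nat a}. \<exists>y\<in>topspace sphere2_space. (e (int i) \<circ> h) y = f"
      using rx by (intro bexI[of _ "nat r"] bexI[of _ "h' x"]) (auto simp: sphere2_space_def)
  qed (use Hausdorff in \<open>auto simp: sphere2_space_def compact_space_subtopology\<close>)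
  then show ?thesis
    by blast
qed

section \<open>The complexes C(n1,n2,n3)\<close>

definition upper_triangle :: "nat \<Rightarrow> nat \<Rightarrow> nat \<Rightarrow> int \<Rightarrow> int set" where
  "upper_triangle n1 n2 n3 k = {k mod cyc_N n1 n2 n3, (k + int n1) mod cyc_N n1 n2 n3,
     (k + int n1 + int n2) mod cyc_N n1 n2 n3}"

text \<open>An inverted triangle of the complex, rebased at its last vertex: it becomes the other
  half of the lattice parallelogram spanned by n1 and n2 at \<open>k\<close>.\<close>

definition lower_triangle :: "nat \<Rightarrow> nat \<Rightarrow> nat \<Rightarrow> int \<Rightarrow> int set" where
  "lower_triangle n1 n2 n3 k = {k mod cyc_N n1 n2 n3, (k + int n2) mod cyc_N n1 n2 n3,
     (k + int n1 + int n2) mod cyc_N n1 n2 n3}"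

lemma upper_triangle_in_cyc_complex: "upper_triangle n1 n2 n3 k \<in> cyc_complex n1 n2 n3"
  unfolding upper_triangle_def cyc_complex_def cyc_triangles_def by blast

lemma lower_triangle_eq:
  "lower_triangle n1 n2 n3 k = {(k + int n1 + int n2) mod cyc_N n1 n2 n3,
     (k + int n1 + int n2 - int n1) mod cyc_N n1 n2 n3,
     (k + int n1 + int n2 - int n1 - int n2) mod cyc_N n1 n2 n3}"
proof -
  have "k + int n1 + int n2 - int n1 = k + int n2" "k + int n1 + int n2 - int n1 - int n2 = k"
    by simp_all
  then show ?thesis
    unfolding lower_triangle_def by (simp only:) blast
qed

lemma lower_triangle_in_cyc_complex: "lower_triangle n1 n2 n3 k \<in> cyc_complex n1 n2 n3"
  unfolding lower_triangle_eq cyc_complex_def cyc_triangles_def by blast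

lemma cyc_complex_subset_triangle:
  assumes "\<sigma> \<in> cyc_complex n1 n2 n3"
  shows "\<exists>k. \<exists>\<tau>\<in>{upper_triangle n1 n2 n3 k, lower_triangle n1 n2 n3 k}. \<sigma> \<subseteq> \<tau>"
proof -
  let ?N = "cyc_N n1 n2 n3"
  consider (vertex) k where "\<sigma> = {k mod ?N}"
    | (edge) k n where "\<sigma> = {k mod ?N, (k + int n) mod ?N}" "n = n1 \<or> n = n2 \<or> n = n3"
    | (upper) k where "\<sigma> = upper_triangle n1 n2 n3 k"
    | (lower) k where "\<sigma> = {k mod ?N, (k - int n1) mod ?N, (k - int n1 - int n2) mod ?N}"
    using assms unfolding cyc_complex_def cyc_vertices_def cyc_edges_def cyc_triangles_def upper_triangle_def
    by auto
  then show ?thesis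
  proof cases
    case vertex
    then show ?thesis
      by (intro exI[of _ k]) (simp add: upper_triangle_def)
  next
    case edge
    from edge(2) show ?thesis
    proof (elim disjE)
      assume "n = n1"
      then show ?thesis
        using edge(1) by (intro exI[of _ k]) (simp add: upper_triangle_def)
    next
      assume "n = n2"
      then show ?thesis
        using edge(1) by (intro exI[of _ k]) (simp add: lower_triangle_def)
    next
      assume "n = n3"
      \<comment> \<open>An n3-edge closes the triangle that starts at its far end: steps n1 and n2
        from k + n3 lead back to k.\<close>
      have "k + int n3 + int n1 + int n2 = k + ?N"
        by (simp add: cyc_N_def)
      then have "(k + int n3 + int n1 + int n2) mod ?N = k mod ?N"
        by (simp only: mod_add_self2)
      then have "\<sigma> \<subseteq> upper_triangle n1 n2 n3 (k + int n3)"
        using edge(1) \<open>n = n3\<close> unfolding upper_triangle_def by simp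
      then show ?thesis
        by blast
    qed
  next
    case upper
    then show ?thesis
      by blast
  next
    case lower
    then have "\<sigma> = lower_triangle n1 n2 n3 (k - int n1 - int n2)"
      unfolding lower_triangle_eq by simp
    then show ?thesis
      by blast
  qed
qed

lemma cyc_complex_point_in_triangle:
  assumes "f \<in> geom_realization_set (cyc_complex n1 n2 n3)"
  shows "(\<forall>w. f w \<ge> 0) \<and> (\<exists>k. \<exists>\<tau>\<in>{upper_triangle n1 n2 n3 k, lower_triangle n1 n2 n3 k}.
    (\<forall>w. w \<notin> \<tau> \<longrightarrow> f w = 0) \<and> sum f \<tau> = 1)"
proof -
  obtain \<sigma> where \<sigma>: "\<sigma> \<in> cyc_complex n1 n2 n3" "\<And>w. f w \<noteq> 0 \<Longrightarrow> w \<in> \<sigma>" "\<And>w. f w \<ge> 0" "sum f \<sigma> = 1"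
    using assms by (auto simp: geom_realization_set_def)
  obtain k \<tau> where \<tau>: "\<tau> \<in> {upper_triangle n1 n2 n3 k, lower_triangle n1 n2 n3 k}" "\<sigma> \<subseteq> \<tau>"
    using cyc_complex_subset_triangle[OF \<sigma>(1)] by blast
  then have "finite \<tau>"
    by (auto simp: upper_triangle_def lower_triangle_def)
  then have "sum f \<tau> = sum f \<sigma>"
    using \<sigma>(2) \<tau>(2) by (intro sum.mono_neutral_right) auto
  moreover have "\<forall>w. w \<notin> \<tau> \<longrightarrow> f w = 0"
    using \<sigma>(2) \<tau>(2) by blast
  ultimately show ?thesis
    using \<sigma>(3,4) \<tau>(1) by auto
qed

text \<open>Up to sign, the differences (A, B) of star points that could give a relation are (1,
  -1), (1, 2), (2, 1) and (2, 2), meaning n1 = n2, n2 = n3, n1 = n3 and n3 = n1 + n2. The bound on A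
  - B is essential: it removes (2, -1), a relation whenever n2 = 2 n1.\<close>

lemma star_injective_generic:
  assumes "1 \<le> n1" "n1 < n2" "n2 < n3" "n3 \<noteq> n1 + n2"
  shows "star_injective (int n1) (int n2) (cyc_N n1 n2 n3)"
  unfolding star_injective_def
proof (intro allI impI)
  fix a b a' b' :: int
  assume star: "in_star a b" "in_star a' b'"
    and eq: "(a * int n1 + b * int n2) mod cyc_N n1 n2 n3 = (a' * int n1 + b' * int n2) mod cyc_N n1 n2 n3"
  define A B where "A = a - a'" and "B = b - b'"
  define N where "N = int n1 + int n2 + int n3"
  have "N dvd A * int n1 + B * int n2"
    using eq by (simp add: mod_eq_dvd_iff cyc_N_def N_def A_def B_def algebra_simps)
  then obtain t where t: "A * int n1 + B * int n2 = N * t" ..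
  have AB: "\<bar>A\<bar> \<le> 2" "\<bar>B\<bar> \<le> 2" "\<bar>A - B\<bar> \<le> 2"
    using star by (auto simp: in_star_def A_def B_def)
  have "\<bar>A * int n1 + B * int n2\<bar> \<le> \<bar>A\<bar> * int n1 + \<bar>B\<bar> * int n2"
    by (rule order_trans[OF abs_triangle_ineq]) (simp add: abs_mult)
  also have "\<dots> \<le> 2 * int n1 + 2 * int n2"
    using AB by (intro add_mono mult_right_mono) auto
  also have "\<dots> < N * 2"
    using assms by (simp add: N_def)
  finally have "N * \<bar>t\<bar> < N * 2"
    unfolding t abs_mult by (simp add: N_def)
  moreover have "N > 0"
    using assms by (simp add: N_def)
  ultimately have "\<bar>t\<bar> < 2"
    by simp
  then have "t = -1 \<or> t = 0 \<or> t = 1"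
    by auto
  moreover have "A = -2 \<or> A = -1 \<or> A = 0 \<or> A = 1 \<or> A = 2" "B = -2 \<or> B = -1 \<or> B = 0 \<or> B = 1 \<or> B = 2"
    using AB by auto
  ultimately have "A = 0 \<and> B = 0"
    using t AB(3) assms unfolding N_def by (elim disjE) simp_all
  then show "a = a' \<and> b = b'"
    by (simp add: A_def B_def)
qed

text \<open>The edge {0, 2c} joins the ends of a progression and lies in no other triangle unless 2c
  = -2c, that is N = 4c, when {2c, 3c, 0} contains it too. For N = 3c several progressions contain
  it, but they are the same set.\<close>

lemma not_surface_strip:
  fixes c N :: int
  assumes c: "0 < c" "2 * c < N" "N \<noteq> 4 * c"
    and K: "{0, c, 2 * c} \<in> K"
    and sub: "\<And>\<sigma>. \<sigma> \<in> K \<Longrightarrow> \<exists>m. \<sigma> \<subseteq> {m mod N, (m + c) mod N, (m + 2 * c) mod N}"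
  shows "\<not> surface_without_boundary (geom_realization K)"
proof (rule not_surface_if_free_edge[OF K, of 0 "2 * c" c])
  fix \<sigma> assume \<sigma>: "\<sigma> \<in> K" "0 \<in> \<sigma>" "2 * c \<in> \<sigma>"
  then obtain m0 where "\<sigma> \<subseteq> {m0 mod N, (m0 + c) mod N, (m0 + 2 * c) mod N}"
    using sub by blast
  moreover define m where "m = m0 mod N"
  ultimately have m: "\<sigma> \<subseteq> {m, (m + c) mod N, (m + 2 * c) mod N}"
    by (simp add: mod_add_left_eq)
  have "0 \<le> m" "m < N"
    using c by (auto simp: m_def)
  \<comment> \<open>One subtraction of N suffices since m and 2c are below N; membership becomes
    linear arithmetic.\<close>
  then have p: "(m + c) mod N = (if m + c < N then m + c else m + c - N)"
    and q: "(m + 2 * c) mod N = (if m + 2 * c < N then m + 2 * c else m + 2 * c - N)"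
    using c by (auto intro: mod_eqI[of _ _ _ 0] mod_eqI[of _ _ _ 1])
  show "\<sigma> \<subseteq> {0, 2 * c, c}"
  proof
    fix x assume "x \<in> \<sigma>"
    then have "x = m \<or> x = (m + c) mod N \<or> x = (m + 2 * c) mod N"
      "0 = m \<or> 0 = (m + c) mod N \<or> 0 = (m + 2 * c) mod N"
      "2 * c = m \<or> 2 * c = (m + c) mod N \<or> 2 * c = (m + 2 * c) mod N"
      using m \<sigma>(2,3) by blast+
    then have "x = 0 \<or> x = 2 * c \<or> x = c"
      unfolding p q using c \<open>0 \<le> m\<close> \<open>m < N\<close> by (smt (verit))
    then show "x \<in> {0, 2 * c, c}"
      by blast
  qed
qed (use c in auto)

text \<open>Upper and lower triangles coincide and are progressions of step n1; n3 = 2 n1 is the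
  exception N = 4c of the strip.\<close>

lemma not_surface_n1_eq_n2:
  assumes "1 \<le> n1" "n1 \<le> n3" "n3 \<noteq> 2 * n1"
  shows "\<not> surface_without_boundary (geom_realization (cyc_complex n1 n1 n3))"
proof (rule not_surface_strip[of "int n1" "cyc_N n1 n1 n3"])
  show "0 < int n1" "2 * int n1 < cyc_N n1 n1 n3" "cyc_N n1 n1 n3 \<noteq> 4 * int n1"
    using assms by (auto simp: cyc_N_def)
  have tri: "upper_triangle n1 n1 n3 k = {k mod cyc_N n1 n1 n3, (k + int n1) mod cyc_N n1 n1 n3,
      (k + 2 * int n1) mod cyc_N n1 n1 n3}" "lower_triangle n1 n1 n3 k = upper_triangle n1 n1 n3 k" for k
    by (simp_all add: upper_triangle_def lower_triangle_def algebra_simps)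
  have "upper_triangle n1 n1 n3 0 = {0, int n1, 2 * int n1}"
    using assms by (simp add: tri cyc_N_def)
  then show "{0, int n1, 2 * int n1} \<in> cyc_complex n1 n1 n3"
    using upper_triangle_in_cyc_complex by metis
  fix \<sigma> assume "\<sigma> \<in> cyc_complex n1 n1 n3"
  then obtain k where "\<sigma> \<subseteq> upper_triangle n1 n1 n3 k"
    using cyc_complex_subset_triangle[of \<sigma> n1 n1 n3] by (auto simp: tri(2))
  then show "\<exists>m. \<sigma> \<subseteq> {m mod cyc_N n1 n1 n3, (m + int n1) mod cyc_N n1 n1 n3, (m + 2 * int n1) mod cyc_N n1 n1 n3}"
    unfolding tri(1) by blast
qed

text \<open>Now n1 is congruent to -2 n2, so rebasing turns every triangle into a progression of
  step n2. The exception N = 4 n2 would need n1 = 2 n2.\<close>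

lemma not_surface_n2_eq_n3:
  assumes "1 \<le> n1" "n1 < n2"
  shows "\<not> surface_without_boundary (geom_realization (cyc_complex n1 n2 n2))"
proof (rule not_surface_strip[of "int n2" "cyc_N n1 n2 n2"])
  let ?N = "cyc_N n1 n2 n2"
  show "0 < int n2" "2 * int n2 < ?N" "?N \<noteq> 4 * int n2"
    using assms by (auto simp: cyc_N_def)
  have upper: "upper_triangle n1 n2 n2 k = {(k - 2 * int n2) mod ?N,
      (k - 2 * int n2 + int n2) mod ?N, (k - 2 * int n2 + 2 * int n2) mod ?N}" for k
  proof -
    have "(k + int n1) mod ?N = (k - 2 * int n2) mod ?N"
      "(k + int n1 + int n2) mod ?N = (k - 2 * int n2 + int n2) mod ?N"
      by (rule mod_eq_dvd_iff[THEN iffD2], simp add: cyc_N_def algebra_simps)+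
    then show ?thesis
      unfolding upper_triangle_def by auto
  qed
  have lower: "lower_triangle n1 n2 n2 k = {(k - int n2) mod ?N,
      (k - int n2 + int n2) mod ?N, (k - int n2 + 2 * int n2) mod ?N}" for k
  proof -
    have "(k + int n1 + int n2) mod ?N = (k - int n2) mod ?N"
      by (rule mod_eq_dvd_iff[THEN iffD2], simp add: cyc_N_def algebra_simps)
    then show ?thesis
      unfolding lower_triangle_def by (auto simp: add.commute)
  qed
  have "upper_triangle n1 n2 n2 (2 * int n2) = {0, int n2, 2 * int n2}"
    using assms by (simp add: upper cyc_N_def)
  then show "{0, int n2, 2 * int n2} \<in> cyc_complex n1 n2 n2"
    using upper_triangle_in_cyc_complex by metis
  fix \<sigma> assume "\<sigma> \<in> cyc_complex n1 n2 n2"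
  then obtain k where "\<sigma> \<subseteq> upper_triangle n1 n2 n2 k \<or> \<sigma> \<subseteq> lower_triangle n1 n2 n2 k"
    using cyc_complex_subset_triangle by blast
  then show "\<exists>m. \<sigma> \<subseteq> {m mod ?N, (m + int n2) mod ?N, (m + 2 * int n2) mod ?N}"
    unfolding upper lower by blast
qed

text \<open>As n3 is half of N, translation by n3 maps the edge {0, n3} to itself, so it lies in the
  upper and lower triangles based at 0 and at n3. Three of these four are used.\<close>

lemma not_surface_n3_eq_sum:
  assumes "1 \<le> n1" "n1 < n2"
  shows "\<not> surface_without_boundary (geom_realization (cyc_complex n1 n2 (n1 + n2)))"
proof (rule not_surface_if_branching_edge)
  let ?n3 = "n1 + n2"
  have "upper_triangle n1 n2 ?n3 0 = {0, int ?n3, int n1}" "lower_triangle n1 n2 ?n3 0 = {0, int ?n3, int n2}"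
    using assms by (auto simp: upper_triangle_def lower_triangle_def cyc_N_def)
  then show "{0, int ?n3, int n1} \<in> cyc_complex n1 n2 ?n3" "{0, int ?n3, int n2} \<in> cyc_complex n1 n2 ?n3"
    using upper_triangle_in_cyc_complex lower_triangle_in_cyc_complex by metis+
  have "int ?n3 mod cyc_N n1 n2 ?n3 = int ?n3" "(int ?n3 + int n1) mod cyc_N n1 n2 ?n3 = int ?n3 + int n1"
    using assms by (auto simp: cyc_N_def)
  moreover have "(int ?n3 + int n1 + int n2) mod cyc_N n1 n2 ?n3 = 0"
    using assms by (intro mod_eqI[of _ _ _ 1]) (auto simp: cyc_N_def)
  ultimately have "upper_triangle n1 n2 ?n3 (int ?n3) = {0, int ?n3, int ?n3 + int n1}"
    unfolding upper_triangle_def by auto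
  then show "{0, int ?n3, int ?n3 + int n1} \<in> cyc_complex n1 n2 ?n3"
    using upper_triangle_in_cyc_complex by metis
  show "distinct [0, int ?n3, int n1, int n2, int ?n3 + int n1]"
    using assms by simp
qed

lemma cyc_complex_homeomorphic_spheres:
  assumes "1 \<le> n1" "Hausdorff_space (geom_realization (cyc_complex n1 n1 (2 * n1)))"
  shows "\<exists>I :: nat set. geom_realization (cyc_complex n1 n1 (2 * n1))
    homeomorphic_space sum_topology (\<lambda>i. sphere2_space) I"
proof (rule geom_realization_homeomorphic_spheres[of "int n1"])
  have N: "cyc_N n1 n1 (2 * n1) = 4 * int n1"
    by (simp add: cyc_N_def)
  have tri: "upper_triangle n1 n1 (2 * n1) k = {k mod (4 * int n1), (k + int n1) mod (4 * int n1),
      (k + 2 * int n1) mod (4 * int n1)}"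
    "lower_triangle n1 n1 (2 * n1) k = upper_triangle n1 n1 (2 * n1) k" for k
    unfolding upper_triangle_def lower_triangle_def N by (simp_all add: algebra_simps)
  show "{k mod (4 * int n1), (k + int n1) mod (4 * int n1), (k + 2 * int n1) mod (4 * int n1)}
      \<in> cyc_complex n1 n1 (2 * n1)" for k
    using upper_triangle_in_cyc_complex[of n1 n1 "2 * n1" k] unfolding tri .
  show "(\<forall>w. f w \<ge> 0) \<and>
       (\<exists>k. (\<forall>w. w \<notin> {k mod (4 * int n1), (k + int n1) mod (4 * int n1), (k + 2 * int n1) mod (4 * int n1)} \<longrightarrow> f w = 0) \<and>
          sum f {k mod (4 * int n1), (k + int n1) mod (4 * int n1), (k + 2 * int n1) mod (4 * int n1)} = 1)"
    if "f \<in> geom_realization_set (cyc_complex n1 n1 (2 * n1))" for f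
    using cyc_complex_point_in_triangle[OF that] unfolding tri by simp
qed (use assms in auto)

lemma cyc_complex_homeomorphic_tori:
  assumes "1 \<le> n1" "n1 < n2" "n2 < n3" "n3 \<noteq> n1 + n2"
    "Hausdorff_space (geom_realization (cyc_complex n1 n2 n3))"
  shows "\<exists>I :: nat set. geom_realization (cyc_complex n1 n2 n3)
    homeomorphic_space sum_topology (\<lambda>i. torus_space) I"
  using assms star_injective_generic upper_triangle_in_cyc_complex lower_triangle_in_cyc_complex
    cyc_complex_point_in_triangle
  unfolding upper_triangle_def lower_triangle_def
  by (intro geom_realization_homeomorphic_tori[of "cyc_N n1 n2 n3" "int n1" "int n2"]) (auto simp: cyc_N_def)

theorem theorem6p7:
  fixes n1 n2 n3 :: nat
  assumes "1 \<le> n1" and "n1 \<le> n2" and "n2 \<le> n3" and "n3 < n1 + n2 + n3"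
    and "surface_without_boundary (geom_realization (cyc_complex n1 n2 n3))"
  shows "(\<exists>I :: nat set. geom_realization (cyc_complex n1 n2 n3)
            homeomorphic_space sum_topology (\<lambda>i. torus_space) I)
       \<or> (\<exists>I :: nat set. geom_realization (cyc_complex n1 n2 n3)
            homeomorphic_space sum_topology (\<lambda>i. sphere2_space) I)"
proof -
  have Hausdorff: "Hausdorff_space (geom_realization (cyc_complex n1 n2 n3))"
    using assms(5) unfolding surface_without_boundary_def by (elim conjE)
  \<comment> \<open>The equation n3 = n1 + n2 occurs twice: for n1 = n2 the four triangles at an
    n3-edge merge in pairs and give spheres, for n1 < n2 the edge branches.\<close>
  consider "n1 = n2" "n3 = 2 * n1" | "n1 = n2" "n3 \<noteq> 2 * n1" | "n1 < n2" "n2 = n3"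
    | "n1 < n2" "n3 = n1 + n2" | "n1 < n2" "n2 < n3" "n3 \<noteq> n1 + n2"
    using assms by linarith
  then show ?thesis
  proof cases
    case 1
    then show ?thesis
      using cyc_complex_homeomorphic_spheres[of n1] assms(1) Hausdorff by simp
  next
    case 2
    then show ?thesis
      using not_surface_n1_eq_n2[of n1 n3] assms by simp
  next
    case 3
    then show ?thesis
      using not_surface_n2_eq_n3[of n1 n2] assms by simp
  next
    case 4
    then show ?thesis
      using not_surface_n3_eq_sum[of n1 n2] assms by simp
  next
    case 5
    then show ?thesis
      using cyc_complex_homeomorphic_tori[of n1 n2 n3] assms(1) Hausdorff by simp
  qed
qed

end
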